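(* Let $\langle X_m\rangle_{m\ge 0}$ and $\langle Y_n\rangle_{n\ge 0}$ be independent transient Markov chains on the same countable state space $\mathcal S$ that have the same transition probabilities, but possibly different initial states. Then $$\mathbf P\bigl[\mathrm{LE}\langle X_m\rangle_{m\ge 0}\cap\{Y_n : n\ge 0\}\neq\emptyset\bigr]\ \ge\ 2^{-8}\,\mathbf P\bigl[\{X_m : m\ge 0\}\cap\{Y_n : n\ge 0\}\neq\emptyset\bigr].$$
   Context: Angle brackets $\langle\cdots\rangle$ denote sequences and braces $\{\cdots\}$ denote sets. Chains are time-homogeneous with discrete time; a chain is transient if every state is transient, so almost surely each state is visited only finitely often. Loop-erasure: let $\mathcal S$ be a countable set and $\gamma=\langle v_0,v_1,v_2,\ldots\rangle$ a finite or infinite sequence in $\mathcal S$ in which each element of $\mathcal S$ occurs only finitely often. The loop-erasure $\mathrm{LE}(\gamma)=\langle u_0,u_1,u_2,\ldots\rangle$ is constructed inductively: set $u_0:=v_0$. If $u_j$ has been chosen, let $k$ be the last index such that $v_k=u_j$. If $v_k$ is the last element of $\gamma$, then $\mathrm{LE}(\gamma):=\langle u_0,\dots,u_j\rangle$; otherwise set $u_{j+1}:=v_{k+1}$ and continue. $\mathrm{LE}(\gamma)$ stands both for this sequence and for the set of its elements. *)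

theory Defs
  imports "HOL-Probability.Probability"
begin

text \<open>
  The state space is a type of class \<open>countable\<close> carrying the discrete sigma-algebra, and the
  transition probabilities are a kernel \<open>K\<close>: \<open>pmf (K s) t\<close> is the probability of a jump from
  \<open>s\<close> to \<open>t\<close>.
\<close>

definition markov_chain ::
  "'w measure \<Rightarrow> ('s::countable \<Rightarrow> 's pmf) \<Rightarrow> 's \<Rightarrow> (nat \<Rightarrow> 'w \<Rightarrow> 's) \<Rightarrow> bool" where
  "markov_chain M K s X \<longleftrightarrow>
     (\<forall>n. X n \<in> M \<rightarrow>\<^sub>M count_space UNIV) \<and>
     (AE \<omega> in M. X 0 \<omega> = s) \<and>
     (\<forall>n a b. \<P>(\<omega> in M. \<forall>i\<le>n. X i \<omega> = a i) \<noteq> 0 \<longrightarrow>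
        \<P>(\<omega> in M. X (Suc n) \<omega> = b \<bar> \<forall>i\<le>n. X i \<omega> = a i) = pmf (K (a n)) b)"

fun chain_step :: "('s::countable \<Rightarrow> 's pmf) \<Rightarrow> 's \<Rightarrow> nat \<Rightarrow> (nat \<Rightarrow> 's) \<Rightarrow> 's measure" where
  "chain_step K s 0 \<omega> = measure_pmf (return_pmf s)"
| "chain_step K s (Suc n) \<omega> = measure_pmf (K (\<omega> n))"

text \<open>
  The law, on the space of trajectories, of the chain with kernel \<open>K\<close> started at \<open>s\<close>.  Lemma
  \<open>markov_chain_chain_law\<close> below confirms that the coordinate process is such a chain.
\<close>

definition chain_law :: "('s::countable \<Rightarrow> 's pmf) \<Rightarrow> 's \<Rightarrow> (nat \<Rightarrow> 's) measure" where
  "chain_law K s =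
     projective_family.lim UNIV (Ionescu_Tulcea.CI (chain_step K s) (\<lambda>_. count_space UNIV))
       (\<lambda>_. count_space UNIV)"

definition transient_state :: "('s::countable \<Rightarrow> 's pmf) \<Rightarrow> 's \<Rightarrow> bool" where
  "transient_state K s \<longleftrightarrow> \<P>(\<omega> in chain_law K s. \<exists>n\<ge>1. \<omega> n = s) < 1"

definition transient_kernel :: "('s::countable \<Rightarrow> 's pmf) \<Rightarrow> bool" where
  "transient_kernel K \<longleftrightarrow> (\<forall>s. transient_state K s)"

text \<open>
  Loop-erasure of an infinite sequence in which each element occurs only finitely often.  Such a
  sequence has no last element, so the erasure never stops.  When \<open>u\<close> occurs infinitely often,
  \<open>last_visit \<gamma> u\<close> is an unspecified number; for transient chains this has probability zero.
\<close>

definition last_visit :: "(nat \<Rightarrow> 's) \<Rightarrow> 's \<Rightarrow> nat" where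
  "last_visit \<gamma> u = (GREATEST k. \<gamma> k = u)"

primrec loop_erasure :: "(nat \<Rightarrow> 's) \<Rightarrow> nat \<Rightarrow> 's" where
  "loop_erasure \<gamma> 0 = \<gamma> 0"
| "loop_erasure \<gamma> (Suc j) = \<gamma> (Suc (last_visit \<gamma> (loop_erasure \<gamma> j)))"

lemma Ionescu_Tulcea_chain_step:
  fixes K :: "'s::countable \<Rightarrow> 's pmf" and s :: 's
  shows "Ionescu_Tulcea (chain_step K s) (\<lambda>_. count_space UNIV)"
proof (rule Ionescu_Tulcea.intro)
  fix i :: nat
  show "chain_step K s i \<in> (PiM {0..<i} (\<lambda>_. count_space UNIV)) \<rightarrow>\<^sub>M subprob_algebra (count_space UNIV)"
  proof (cases i)
    case 0
    have "chain_step K s 0 = (\<lambda>_. measure_pmf (return_pmf s))"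
      by (rule ext) simp
    then show ?thesis
      using 0 by (simp add: space_subprob_algebra measure_pmf.subprob_space_axioms)
  next
    case (Suc n)
    have "(\<lambda>\<omega>. \<omega> n) \<in> (PiM {0..<i} (\<lambda>_. count_space UNIV)) \<rightarrow>\<^sub>M count_space (UNIV :: 's set)"
      using Suc by (intro measurable_component_singleton) auto
    moreover have "(\<lambda>x. measure_pmf (K x)) \<in> count_space UNIV \<rightarrow>\<^sub>M subprob_algebra (count_space UNIV)"
      by (simp add: space_subprob_algebra measure_pmf.subprob_space_axioms)
    ultimately have "(\<lambda>\<omega>. measure_pmf (K (\<omega> n))) \<in>
        (PiM {0..<i} (\<lambda>_. count_space UNIV)) \<rightarrow>\<^sub>M subprob_algebra (count_space UNIV)"
      by (rule measurable_compose)
    moreover have "chain_step K s i = (\<lambda>\<omega>. measure_pmf (K (\<omega> n)))"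
      using Suc by (intro ext) simp
    ultimately show ?thesis
      by simp
  qed
next
  fix i :: nat and \<omega> :: "nat \<Rightarrow> 's"
  show "prob_space (chain_step K s i \<omega>)"
    by (cases i) (auto intro: measure_pmf.prob_space_axioms)
qed

context
  fixes K :: "'s::countable \<Rightarrow> 's pmf" and s :: 's
begin

interpretation IT: Ionescu_Tulcea "chain_step K s" "\<lambda>_. count_space UNIV"
  by (rule Ionescu_Tulcea_chain_step)

lemma sets_chain_law: "sets (chain_law K s) = sets (PiM UNIV (\<lambda>_. count_space UNIV))"
  unfolding chain_law_def by (rule IT.PF.sets_lim)

lemma space_chain_law: "space (chain_law K s) = UNIV"
  unfolding chain_law_def IT.PF.space_lim by (simp add: space_PiM PiE_def)

lemma emeasure_chain_law_cylinder:
  "emeasure (chain_law K s) {\<omega>. \<forall>i<n. \<omega> i = a i} =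
     (\<Prod>i<n. ennreal (pmf (if i = 0 then return_pmf s else K (a (i - 1))) (a i)))"
proof -
  define A where "A n = PiE {0..<n} (\<lambda>i. {a i})" for n
  have A_sets: "A n \<in> sets (PiM {0..<n} (\<lambda>_. count_space UNIV))" for n
    unfolding A_def by (rule sets_PiM_I_finite) auto
  have C: "emeasure (IT.C 0 n (\<lambda>_. undefined)) (A n) =
     (\<Prod>i<n. ennreal (pmf (if i = 0 then return_pmf s else K (a (i - 1))) (a i)))" for n
  proof (induction n)
    case 0
    then show ?case
      using A_sets[of 0] by (simp add: A_def)
  next
    case (Suc n)
    let ?C = "IT.C 0 n (\<lambda>_. undefined)"
    let ?c = "ennreal (pmf (if n = 0 then return_pmf s else K (a (n - 1))) (a n))"
    have u: "(\<lambda>_. undefined) \<in> space (PiM {0..<0} (\<lambda>_. count_space (UNIV :: 's set)))"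
      by (auto simp: space_PiM PiE_iff extensional_def)
    have sp: "space ?C = space (PiM {0..<n} (\<lambda>_. count_space (UNIV :: 's set)))"
      using IT.space_C[OF u, of n] by simp
    have st: "sets ?C = sets (PiM {0..<n} (\<lambda>_. count_space (UNIV :: 's set)))"
      using IT.sets_C[OF u, of n] by simp
    have ne: "space ?C \<noteq> {}"
      using IT.prob_space_C[OF u, of n] by (rule prob_space.not_empty)
    have "emeasure (IT.C 0 (Suc n) (\<lambda>_. undefined)) (A (Suc n)) =
        (\<integral>\<^sup>+ \<omega>. emeasure (IT.eP n \<omega>) (A (Suc n)) \<partial>?C)"
      using A_sets[of "Suc n"] IT.measurable_eP[of n] ne
      by (simp, intro emeasure_bind) (auto simp: measurable_cong_sets[OF st refl])
    also have "\<dots> = (\<integral>\<^sup>+ \<omega>. ?c * indicator (A n) \<omega> \<partial>?C)"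
    proof (rule nn_integral_cong)
      fix \<omega> assume "\<omega> \<in> space ?C"
      then have w: "\<omega> \<in> space (PiM {0..<n} (\<lambda>_. count_space (UNIV :: 's set)))"
        by (simp add: sp)
      have upd: "(fun_upd \<omega> n) -` (A (Suc n)) = (if \<omega> \<in> A n then {a n} else {})"
        using w by (auto simp: A_def space_PiM PiE_iff extensional_def atLeastLessThanSuc split: if_splits)
      have "emeasure (IT.eP n \<omega>) (A (Suc n)) =
          emeasure (chain_step K s n \<omega>) (if \<omega> \<in> A n then {a n} else {})"
        using IT.emeasure_eP[OF w A_sets[of "Suc n"]] upd by simp
      also have "\<dots> = ?c * indicator (A n) \<omega>"
        by (cases n) (auto simp: emeasure_pmf_single A_def PiE_iff split: split_indicator)
      finally show "emeasure (IT.eP n \<omega>) (A (Suc n)) = ?c * indicator (A n) \<omega>" .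
    qed
    also have "\<dots> = ?c * emeasure ?C (A n)"
      using A_sets[of n] st by (intro nn_integral_cmult_indicator) auto
    finally show ?case
      by (simp add: Suc.IH mult.commute)
  qed
  have "{\<omega>. \<forall>i<n. \<omega> i = a i} = IT.PF.emb UNIV {0..<n} (A n)"
    by (auto simp: prod_emb_def A_def PiE_iff)
  moreover have "IT.PF.emb {0..<n} {0..<n} (A n) = A n"
    by (rule prod_emb_id) (auto simp: A_def PiE_iff)
  ultimately show ?thesis
    unfolding chain_law_def
    using IT.lim[of "{0..<n}" "A n"] IT.emeasure_CI[of "{0..<n}" n "A n"] A_sets[of n] C[of n]
    by simp
qed

lemma prob_space_chain_law: "prob_space (chain_law K s)"
  using emeasure_chain_law_cylinder[of 0] by (intro prob_spaceI) (simp add: space_chain_law)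

lemma markov_chain_chain_law: "markov_chain (chain_law K s) K s (\<lambda>n \<omega>. \<omega> n)"
proof -
  interpret L: prob_space "chain_law K s"
    by (rule prob_space_chain_law)
  have meas: "(\<lambda>\<omega>. \<omega> n) \<in> chain_law K s \<rightarrow>\<^sub>M count_space UNIV" for n :: nat
    unfolding measurable_cong_sets[OF sets_chain_law refl]
    by (rule measurable_component_singleton) simp
  have cyl: "L.prob {\<omega>. \<forall>i<n. \<omega> i = a i} =
      (\<Prod>i<n. pmf (if i = 0 then return_pmf s else K (a (i - 1))) (a i))" for n a
    using emeasure_chain_law_cylinder[of n a]
    unfolding measure_def by (subst (asm) prod_ennreal) (simp_all add: prod_nonneg)
  have ev: "{\<omega>. \<forall>i\<le>n. \<omega> i = a i} = {\<omega>. \<forall>i<Suc n. \<omega> i = a i}" for a :: "nat \<Rightarrow> 's" and n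
    by (auto simp: less_Suc_eq_le)
  have "L.prob {\<omega>. \<omega> 0 = s} = 1"
    using cyl[of 1 "\<lambda>_. s"] by simp
  then have init: "AE \<omega> in chain_law K s. \<omega> 0 = s"
    using L.AE_prob_1 by fastforce
  have step: "\<P>(\<omega> in chain_law K s. \<omega> (Suc n) = b \<bar> \<forall>i\<le>n. \<omega> i = a i) = pmf (K (a n)) b"
    if "\<P>(\<omega> in chain_law K s. \<forall>i\<le>n. \<omega> i = a i) \<noteq> 0" for n a b
  proof -
    have eq: "{\<omega>. \<omega> (Suc n) = b \<and> (\<forall>i\<le>n. \<omega> i = a i)} =
        {\<omega>. \<forall>i<Suc (Suc n). \<omega> i = (a(Suc n := b)) i}"
      by (rule Collect_cong) (simp add: less_Suc_eq_le le_Suc_eq all_conj_distrib imp_conjL conj_commute)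
    have "L.prob {\<omega>. \<forall>i<Suc (Suc n). \<omega> i = (a(Suc n := b)) i} =
        L.prob {\<omega>. \<forall>i<Suc n. \<omega> i = a i} * pmf (K (a n)) b"
      unfolding cyl prod.lessThan_Suc[of _ "Suc n"]
      by (intro arg_cong2[where f = "(*)"] prod.cong) auto
    moreover have "L.prob {\<omega>. \<forall>i<Suc n. \<omega> i = a i} \<noteq> 0"
      using that unfolding space_chain_law ev[symmetric] by simp
    ultimately show ?thesis
      unfolding cond_prob_def space_chain_law by (simp only: UNIV_I simp_thms eq ev) simp
  qed
  show ?thesis
    unfolding markov_chain_def using meas init step by blast
qed

end

end

theory Submission
  imports Defs
begin

text \<open>
  Let \<open>(\<tau>, \<lambda>)\<close> be the lexicographically first pair of times below \<open>N\<close> with \<open>X\<^sub>\<tau> = Y\<^sub>\<lambda>\<close>, and let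
  \<open>S\<close> be the sum over \<open>m, n < N\<close> of \<open>P((\<tau>, \<lambda>) = (m, n) | X\<^sub>m, Y\<^sub>n)\<close>.  Then \<open>E S\<close> is the probability
  \<open>p\<close> of a meeting before time \<open>N\<close>.  Conditioning on \<open>X\<^sub>m\<close> is conditioning on the past followed by
  conditioning on the future, and each such conditioning of the summands at most quadruples the second
  moment of the sum (dual Doob inequality).  The event \<open>\<tau> = m\<close> does not look at the future of \<open>X\<close>, so
  only three conditionings are needed in total, and \<open>E S\<^sup>2 \<le> 64 p\<close>.

  When \<open>X\<^sub>m = Y\<^sub>n\<close>, the futures of both chains are independent with the same law, so with probability
  at least \<open>1/2\<close> the future of \<open>Y\<close> hits the loop-erasure of \<open>X\<^sub>0, \<dots>, X\<^sub>m\<close> no later along this path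
  than the future of \<open>X\<close> does.  The point hit then survives in the loop-erasure of the whole path of
  \<open>X\<close>.  Restricting \<open>S\<close> to these events loses at most half of its mean, and the second moment method
  bounds the probability of a hit below by \<open>(p/2)\<^sup>2 / (64 p) = p / 256\<close>.
\<close>

section \<open>Averages over fibres and the dual Doob inequality\<close>

text \<open>The conditional expectation of \<open>f\<close> given \<open>Z = z\<close>, as a
  function of the value \<open>z\<close>. It is used for countably valued \<open>Z\<close>; on a
  null fibre the numerator vanishes as well and the quotient is 0.\<close>

definition cond_avg :: "'a measure \<Rightarrow> ('a \<Rightarrow> 'c) \<Rightarrow> ('a \<Rightarrow> ennreal) \<Rightarrow> 'c \<Rightarrow> ennreal" where
  "cond_avg M Z f z = (\<integral>\<^sup>+\<omega>. f \<omega> * indicator {z} (Z \<omega>) \<partial>M) / emeasure M {\<omega> \<in> space M. Z \<omega> = z}"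

text \<open>The indicators of the countably many fibres of \<open>Z\<close> sum to 1, and Tonelli
  with the counting measure exchanges sum and integral.\<close>

lemma nn_integral_partition:
  fixes Z :: "'a \<Rightarrow> 'c::countable"
  assumes [measurable]: "f \<in> borel_measurable M" "Z \<in> M \<rightarrow>\<^sub>M count_space UNIV"
  shows "(\<integral>\<^sup>+\<omega>. f \<omega> * \<phi> (Z \<omega>) \<partial>M) =
    (\<integral>\<^sup>+z. (\<integral>\<^sup>+\<omega>. f \<omega> * indicator {z} (Z \<omega>) \<partial>M) * \<phi> z \<partial>count_space UNIV)"
proof -
  have "f \<omega> * \<phi> (Z \<omega>) = (\<integral>\<^sup>+z. f \<omega> * indicator {z} (Z \<omega>) * \<phi> z \<partial>count_space UNIV)" for \<omega>
  proof -
    have "(\<integral>\<^sup>+z. f \<omega> * indicator {z} (Z \<omega>) * \<phi> z \<partial>count_space UNIV) =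
        (\<integral>\<^sup>+z. f \<omega> * \<phi> z * indicator {Z \<omega>} z \<partial>count_space UNIV)"
      by (intro nn_integral_cong) (auto split: split_indicator)
    also have "\<dots> = f \<omega> * \<phi> (Z \<omega>)"
      by (subst nn_integral_indicator_finite) auto
    finally show ?thesis by simp
  qed
  then have "(\<integral>\<^sup>+\<omega>. f \<omega> * \<phi> (Z \<omega>) \<partial>M) =
      (\<integral>\<^sup>+\<omega>. (\<integral>\<^sup>+z. f \<omega> * indicator {z} (Z \<omega>) * \<phi> z \<partial>count_space UNIV) \<partial>M)"
    by simp
  also have "\<dots> = (\<integral>\<^sup>+z. (\<integral>\<^sup>+\<omega>. f \<omega> * indicator {z} (Z \<omega>) * \<phi> z \<partial>M) \<partial>count_space UNIV)"
    by (rule nn_integral_count_space_nn_integral) auto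
  also have "\<dots> = (\<integral>\<^sup>+z. (\<integral>\<^sup>+\<omega>. f \<omega> * indicator {z} (Z \<omega>) \<partial>M) * \<phi> z \<partial>count_space UNIV)"
    by (intro nn_integral_cong nn_integral_multc) auto
  finally show ?thesis .
qed

lemma nn_integral_eq_0_on_null_fibre:
  fixes Z :: "'a \<Rightarrow> 'c::countable"
  assumes [measurable]: "Z \<in> M \<rightarrow>\<^sub>M count_space UNIV"
    and null: "emeasure M {\<omega> \<in> space M. Z \<omega> = z} = 0"
  shows "(\<integral>\<^sup>+\<omega>. f \<omega> * indicator {z} (Z \<omega>) \<partial>M) = 0"
proof -
  have "AE \<omega> in M. \<not> Z \<omega> = z"
    using null by (subst AE_iff_measurable[of "{\<omega> \<in> space M. Z \<omega> = z}"]) auto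
  then have "AE \<omega> in M. f \<omega> * indicator {z} (Z \<omega>) = 0"
    by eventually_elim auto
  then have "(\<integral>\<^sup>+\<omega>. f \<omega> * indicator {z} (Z \<omega>) \<partial>M) = (\<integral>\<^sup>+\<omega>. 0 \<partial>M)"
    by (rule nn_integral_cong_AE)
  then show ?thesis by simp
qed

lemma (in finite_measure) cond_avg_mult_emeasure:
  fixes Z :: "'a \<Rightarrow> 'c::countable"
  assumes [measurable]: "Z \<in> M \<rightarrow>\<^sub>M count_space UNIV"
  shows "cond_avg M Z f z * emeasure M {\<omega> \<in> space M. Z \<omega> = z} =
    (\<integral>\<^sup>+\<omega>. f \<omega> * indicator {z} (Z \<omega>) \<partial>M)"
proof (cases "emeasure M {\<omega> \<in> space M. Z \<omega> = z} = 0")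
  case True
  then show ?thesis
    by (simp add: nn_integral_eq_0_on_null_fibre)
next
  case False
  then show ?thesis
    unfolding cond_avg_def
    by (simp add: ennreal_divide_times ennreal_times_divide[symmetric] ennreal_divide_self less_top[symmetric])
qed

text \<open>The characteristic property of conditional expectation, tested against functions of
  \<open>Z\<close>: on each fibre \<open>f\<close> and its average have the same integral.\<close>

lemma (in finite_measure) nn_integral_cond_avg:
  fixes Z :: "'a \<Rightarrow> 'c::countable"
  assumes [measurable]: "f \<in> borel_measurable M" "Z \<in> M \<rightarrow>\<^sub>M count_space UNIV"
  shows "(\<integral>\<^sup>+\<omega>. cond_avg M Z f (Z \<omega>) * \<phi> (Z \<omega>) \<partial>M) = (\<integral>\<^sup>+\<omega>. f \<omega> * \<phi> (Z \<omega>) \<partial>M)"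
proof -
  have "(\<integral>\<^sup>+\<omega>. cond_avg M Z f (Z \<omega>) * indicator {z} (Z \<omega>) \<partial>M) =
      (\<integral>\<^sup>+\<omega>. f \<omega> * indicator {z} (Z \<omega>) \<partial>M)" for z
  proof -
    have "(\<integral>\<^sup>+\<omega>. cond_avg M Z f (Z \<omega>) * indicator {z} (Z \<omega>) \<partial>M) =
        (\<integral>\<^sup>+\<omega>. cond_avg M Z f z * indicator {\<omega> \<in> space M. Z \<omega> = z} \<omega> \<partial>M)"
      by (intro nn_integral_cong) (auto split: split_indicator)
    also have "\<dots> = cond_avg M Z f z * emeasure M {\<omega> \<in> space M. Z \<omega> = z}"
      by (intro nn_integral_cmult_indicator) auto
    finally show ?thesis
      by (simp add: cond_avg_mult_emeasure)
  qed
  then show ?thesis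
    by (subst (1 2) nn_integral_partition) auto
qed

lemma (in finite_measure) cond_avg_le:
  fixes Z :: "'a \<Rightarrow> 'c::countable"
  assumes [measurable]: "Z \<in> M \<rightarrow>\<^sub>M count_space UNIV" and f: "\<And>\<omega>. f \<omega> \<le> c"
  shows "cond_avg M Z f z \<le> c"
proof -
  let ?E = "{\<omega> \<in> space M. Z \<omega> = z}"
  have "(\<integral>\<^sup>+\<omega>. f \<omega> * indicator {z} (Z \<omega>) \<partial>M) \<le> (\<integral>\<^sup>+\<omega>. c * indicator ?E \<omega> \<partial>M)"
    using f by (intro nn_integral_mono) (auto split: split_indicator)
  also have "\<dots> = c * emeasure M ?E"
    by (intro nn_integral_cmult_indicator) auto
  finally have *: "(\<integral>\<^sup>+\<omega>. f \<omega> * indicator {z} (Z \<omega>) \<partial>M) \<le> c * emeasure M ?E" .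
  show ?thesis
  proof (cases "emeasure M ?E = 0")
    case True
    then show ?thesis
      by (simp add: cond_avg_def nn_integral_eq_0_on_null_fibre)
  next
    case False
    then have "cond_avg M Z f z \<le> c * emeasure M ?E / emeasure M ?E"
      unfolding cond_avg_def using * by (intro divide_right_mono_ennreal)
    also have "\<dots> = c"
      using False by (intro mult_divide_eq_ennreal) auto
    finally show ?thesis .
  qed
qed

lemma cond_avg_sum:
  fixes Z :: "'a \<Rightarrow> 'c::countable"
  assumes [measurable]: "Z \<in> M \<rightarrow>\<^sub>M count_space UNIV" "\<And>i. i \<in> I \<Longrightarrow> f i \<in> borel_measurable M"
  shows "cond_avg M Z (\<lambda>\<omega>. \<Sum>i\<in>I. f i \<omega>) z = (\<Sum>i\<in>I. cond_avg M Z (f i) z)"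
  unfolding cond_avg_def divide_ennreal_def sum_distrib_right
  by (subst nn_integral_sum) (auto simp: sum_distrib_right)

text \<open>The square of \<open>a - 2 * b\<close> is nonnegative, written without subtraction. It
  stands in for Cauchy-Schwarz, both in \<open>dual_doob\<close> and in the final second moment
  argument.\<close>

lemma ennreal_four_mult_le: "4 * (a * b) \<le> a\<^sup>2 + 4 * b\<^sup>2" for a b :: ennreal
proof (cases a; cases b)
  fix r s :: real assume ab: "a = ennreal r" "0 \<le> r" "b = ennreal s" "0 \<le> s"
  have "4 * (r * s) \<le> r\<^sup>2 + 4 * s\<^sup>2"
    using zero_le_power2[of "r - 2 * s"] by (simp add: power2_eq_square algebra_simps)
  then have "ennreal (4 * (r * s)) \<le> ennreal (r\<^sup>2 + 4 * s\<^sup>2)"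
    by (rule ennreal_leI)
  moreover have "ennreal (4 * (r * s)) = 4 * (a * b)"
    using ab by (simp add: ennreal_mult ennreal_numeral[symmetric] del: ennreal_numeral)
  moreover have "ennreal (r\<^sup>2 + 4 * s\<^sup>2) = a\<^sup>2 + 4 * b\<^sup>2"
    using ab by (simp add: ennreal_mult ennreal_numeral[symmetric] ennreal_power del: ennreal_numeral)
  ultimately show ?thesis by simp
qed (auto simp: ennreal_top_mult ennreal_mult_top power2_eq_square)

text \<open>
  A dual form of Doob's \<open>L\<^sup>2\<close> inequality: the hypothesis on the inner products holds for conditional
  expectations \<open>h i = E[f i | F\<^sub>i]\<close> along any monotone family of sigma-algebras, since one of
  \<open>h i\<close>, \<open>h j\<close> is then measurable for the sigma-algebra defining the other.
\<close>

lemma dual_doob: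
  fixes f h :: "'i \<Rightarrow> 'a \<Rightarrow> ennreal"
  assumes [measurable]: "\<And>i. i \<in> I \<Longrightarrow> f i \<in> borel_measurable M" "\<And>i. i \<in> I \<Longrightarrow> h i \<in> borel_measurable M"
    and fin: "(\<integral>\<^sup>+\<omega>. (\<Sum>i\<in>I. h i \<omega>)\<^sup>2 \<partial>M) < \<infinity>"
    and inner: "\<And>i j. i \<in> I \<Longrightarrow> j \<in> I \<Longrightarrow>
      (\<integral>\<^sup>+\<omega>. h i \<omega> * h j \<omega> \<partial>M) \<le> (\<integral>\<^sup>+\<omega>. h i \<omega> * f j \<omega> \<partial>M) + (\<integral>\<^sup>+\<omega>. f i \<omega> * h j \<omega> \<partial>M)"
  shows "(\<integral>\<^sup>+\<omega>. (\<Sum>i\<in>I. h i \<omega>)\<^sup>2 \<partial>M) \<le> 4 * (\<integral>\<^sup>+\<omega>. (\<Sum>i\<in>I. f i \<omega>)\<^sup>2 \<partial>M)"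
proof -
  define F H where "F \<omega> = (\<Sum>i\<in>I. f i \<omega>)" and "H \<omega> = (\<Sum>i\<in>I. h i \<omega>)" for \<omega>
  have [measurable]: "F \<in> borel_measurable M" "H \<in> borel_measurable M"
    unfolding F_def H_def by measurable
  have expand: "(\<integral>\<^sup>+\<omega>. (\<Sum>i\<in>I. u i \<omega>) * (\<Sum>j\<in>I. v j \<omega>) \<partial>M) =
      (\<Sum>i\<in>I. \<Sum>j\<in>I. \<integral>\<^sup>+\<omega>. u i \<omega> * v j \<omega> \<partial>M)"
    if [measurable]: "\<And>i. i \<in> I \<Longrightarrow> u i \<in> borel_measurable M" "\<And>i. i \<in> I \<Longrightarrow> v i \<in> borel_measurable M"
    for u v :: "'i \<Rightarrow> 'a \<Rightarrow> ennreal"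
    by (simp add: sum_product nn_integral_sum)
  have "(\<integral>\<^sup>+\<omega>. (H \<omega>)\<^sup>2 \<partial>M) = (\<Sum>i\<in>I. \<Sum>j\<in>I. \<integral>\<^sup>+\<omega>. h i \<omega> * h j \<omega> \<partial>M)"
    unfolding H_def power2_eq_square by (rule expand) auto
  also have "\<dots> \<le> (\<Sum>i\<in>I. \<Sum>j\<in>I. (\<integral>\<^sup>+\<omega>. h i \<omega> * f j \<omega> \<partial>M) + (\<integral>\<^sup>+\<omega>. f i \<omega> * h j \<omega> \<partial>M))"
    by (intro sum_mono inner)
  also have "\<dots> = (\<integral>\<^sup>+\<omega>. H \<omega> * F \<omega> \<partial>M) + (\<integral>\<^sup>+\<omega>. F \<omega> * H \<omega> \<partial>M)"
    unfolding F_def H_def by (simp add: expand sum.distrib)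
  also have "\<dots> = 2 * (\<integral>\<^sup>+\<omega>. H \<omega> * F \<omega> \<partial>M)"
    by (simp add: mult.commute mult_2)
  finally have 1: "(\<integral>\<^sup>+\<omega>. (H \<omega>)\<^sup>2 \<partial>M) \<le> 2 * (\<integral>\<^sup>+\<omega>. H \<omega> * F \<omega> \<partial>M)" .
  \<comment> \<open>Doubling produces \<open>4 * (H \<omega> * F \<omega>)\<close>, which
    \<open>ennreal_four_mult_le\<close> splits. One copy of the second moment of \<open>H\<close>
    then cancels, because \<open>fin\<close> makes it finite, and the constant 4 remains.\<close>
  have "(\<integral>\<^sup>+\<omega>. (H \<omega>)\<^sup>2 \<partial>M) + (\<integral>\<^sup>+\<omega>. (H \<omega>)\<^sup>2 \<partial>M) = 2 * (\<integral>\<^sup>+\<omega>. (H \<omega>)\<^sup>2 \<partial>M)"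
    by (simp add: mult_2)
  also have "\<dots> \<le> 2 * (2 * (\<integral>\<^sup>+\<omega>. H \<omega> * F \<omega> \<partial>M))"
    using 1 by (rule mult_left_mono) simp
  also have "\<dots> = 4 * (\<integral>\<^sup>+\<omega>. H \<omega> * F \<omega> \<partial>M)"
    by (simp add: mult.assoc[symmetric])
  also have "\<dots> = (\<integral>\<^sup>+\<omega>. 4 * (H \<omega> * F \<omega>) \<partial>M)"
    by (simp add: nn_integral_cmult)
  also have "\<dots> \<le> (\<integral>\<^sup>+\<omega>. (H \<omega>)\<^sup>2 + 4 * (F \<omega>)\<^sup>2 \<partial>M)"
    by (intro nn_integral_mono ennreal_four_mult_le)
  also have "\<dots> = (\<integral>\<^sup>+\<omega>. (H \<omega>)\<^sup>2 \<partial>M) + 4 * (\<integral>\<^sup>+\<omega>. (F \<omega>)\<^sup>2 \<partial>M)"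
    by (simp add: nn_integral_add nn_integral_cmult)
  finally have "(\<integral>\<^sup>+\<omega>. (H \<omega>)\<^sup>2 \<partial>M) + (\<integral>\<^sup>+\<omega>. (H \<omega>)\<^sup>2 \<partial>M)
      \<le> (\<integral>\<^sup>+\<omega>. (H \<omega>)\<^sup>2 \<partial>M) + 4 * (\<integral>\<^sup>+\<omega>. (F \<omega>)\<^sup>2 \<partial>M)" .
  moreover have "(\<integral>\<^sup>+\<omega>. (H \<omega>)\<^sup>2 \<partial>M) \<noteq> \<infinity>"
    using fin by (simp add: H_def)
  ultimately have "(\<integral>\<^sup>+\<omega>. (H \<omega>)\<^sup>2 \<partial>M) \<le> 4 * (\<integral>\<^sup>+\<omega>. (F \<omega>)\<^sup>2 \<partial>M)"
    by (simp add: ennreal_add_left_cancel_le)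
  then show ?thesis
    by (simp add: F_def H_def)
qed

section \<open>The Markov property on trajectories\<close>

abbreviation seq_space :: "(nat \<Rightarrow> 's) measure" where
  "seq_space \<equiv> PiM UNIV (\<lambda>_. count_space UNIV)"

abbreviation cylinder :: "nat \<Rightarrow> (nat \<Rightarrow> 's) \<Rightarrow> (nat \<Rightarrow> 's) set" where
  "cylinder n a \<equiv> {\<omega>. \<forall>i<n. \<omega> i = a i}"

lemma measurable_seq_nth [measurable]: "(\<lambda>\<omega>. \<omega> n) \<in> seq_space \<rightarrow>\<^sub>M count_space UNIV"
  by (rule measurable_component_singleton) simp

lemma space_seq_space [simp]: "space seq_space = UNIV"
  by (simp add: space_PiM)

lemma cylinder_in_sets [measurable]: "cylinder n a \<in> sets (seq_space :: (nat \<Rightarrow> 's::countable) measure)"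
proof -
  have "{\<omega> \<in> space (seq_space :: (nat \<Rightarrow> 's) measure). \<forall>i<n. \<omega> i = a i} \<in> sets seq_space"
    by measurable
  then show ?thesis by simp
qed

lemma measurable_prefix [measurable]:
  "(\<lambda>\<omega> :: nat \<Rightarrow> 's::countable. map \<omega> [0..<n]) \<in> seq_space \<rightarrow>\<^sub>M count_space UNIV"
proof -
  have "(\<lambda>\<omega>. map \<omega> [0..<n]) -` {z} \<inter> space (seq_space :: (nat \<Rightarrow> 's) measure) \<in> sets seq_space" for z
  proof (cases "length z = n")
    case True
    then have "(\<lambda>\<omega>. map \<omega> [0..<n]) -` {z} \<inter> space seq_space = cylinder n (\<lambda>i. z ! i)"
      by (intro set_eqI) (simp add: list_eq_iff_nth_eq)
    then show ?thesis
      by (simp only: cylinder_in_sets)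
  next
    case False
    then have "(\<lambda>\<omega>. map \<omega> [0..<n]) -` {z} \<inter> space seq_space = ({} :: (nat \<Rightarrow> 's) set)"
      by auto
    then show ?thesis by simp
  qed
  then show ?thesis
    by (simp add: measurable_count_space_eq2_countable)
qed

text \<open>The function factors through the list of the first \<open>n\<close> entries, which
  ranges over a countable discrete space.\<close>

lemma measurable_prefix_determined:
  fixes f :: "(nat \<Rightarrow> 's::countable) \<Rightarrow> 'b"
  assumes "\<And>a a'. (\<And>i. i < n \<Longrightarrow> a i = a' i) \<Longrightarrow> f a = f a'" and "\<And>a. f a \<in> space N"
  shows "f \<in> seq_space \<rightarrow>\<^sub>M N"
proof -
  have "(\<lambda>a. f (\<lambda>i. map a [0..<n] ! i)) \<in> seq_space \<rightarrow>\<^sub>M N"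
    using assms(2) by (intro measurable_compose[OF measurable_prefix[of n]]) auto
  moreover have "f (\<lambda>i. map a [0..<n] ! i) = f a" for a
    by (rule assms(1)) simp
  ultimately show ?thesis by simp
qed

lemma sets_seq_space_eq_sigma_sets:
  "sets (seq_space :: (nat \<Rightarrow> 's::countable) measure) =
    sigma_sets UNIV (insert {} (range (\<lambda>(n, a). cylinder n a)))" (is "_ = sigma_sets UNIV ?E")
proof
  have "?E \<subseteq> sets (seq_space :: (nat \<Rightarrow> 's) measure)"
    by (auto intro: cylinder_in_sets)
  then show "sigma_sets UNIV ?E \<subseteq> sets (seq_space :: (nat \<Rightarrow> 's) measure)"
    using sets.sigma_sets_subset[of ?E "seq_space :: (nat \<Rightarrow> 's) measure"] by simp
next
  let ?S = "sigma (UNIV :: (nat \<Rightarrow> 's) set) ?E"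
  have "(\<lambda>\<omega>. \<omega>) \<in> ?S \<rightarrow>\<^sub>M (seq_space :: (nat \<Rightarrow> 's) measure)"
  proof (rule measurable_PiM_single')
    fix i :: nat
    have "{\<omega> :: nat \<Rightarrow> 's. \<omega> i = t} \<in> sets ?S" for t
    proof -
      \<comment> \<open>Indexing the cylinders by lists instead of sequences makes this union
        countable.\<close>
      have "{\<omega> :: nat \<Rightarrow> 's. \<omega> i = t} = (\<Union>l\<in>{l. l ! i = t}. cylinder (Suc i) (\<lambda>j. l ! j))"
      proof safe
        fix \<omega> :: "nat \<Rightarrow> 's" assume "t = \<omega> i"
        then show "\<omega> \<in> (\<Union>l\<in>{l. l ! i = \<omega> i}. cylinder (Suc i) (\<lambda>j. l ! j))"
          by (intro UN_I[of "map \<omega> [0..<Suc i]"]) (auto simp del: upt_Suc)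
      qed auto
      also have "\<dots> \<in> sets ?S"
        by (intro sets.countable_UN') auto
      finally show ?thesis .
    qed
    then show "(\<lambda>\<omega>. \<omega> i) \<in> ?S \<rightarrow>\<^sub>M count_space UNIV"
      by (auto simp: measurable_count_space_eq2_countable vimage_def)
  qed auto
  then have "A \<in> sets ?S" if "A \<in> sets seq_space" for A
    using measurable_sets[of "\<lambda>\<omega>. \<omega>" ?S seq_space A] that by simp
  then show "sets (seq_space :: (nat \<Rightarrow> 's) measure) \<subseteq> sigma_sets UNIV ?E"
    by auto
qed

text \<open>Uniqueness by the pi-lambda theorem: two cylinders are either nested or disjoint, and
  the empty set belongs to the generator for the latter case.\<close>

lemma measure_eqI_cylinder:
  fixes \<mu> \<nu> :: "(nat \<Rightarrow> 's::countable) measure"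
  assumes "finite_measure \<mu>" "sets \<mu> = sets seq_space" "sets \<nu> = sets seq_space"
    and eq: "\<And>n a. emeasure \<mu> (cylinder n a) = emeasure \<nu> (cylinder n a)"
  shows "\<mu> = \<nu>"
proof (rule measure_eqI_generator_eq[where A = "\<lambda>_. UNIV"])
  let ?E = "insert {} (range (\<lambda>(n, a). cylinder n (a :: nat \<Rightarrow> 's)))"
  show "Int_stable ?E"
  proof (rule Int_stableI)
    have le: "cylinder n a \<inter> cylinder m b \<in> ?E" if "n \<le> m" for n m and a b :: "nat \<Rightarrow> 's"
    proof (cases "\<forall>i<n. a i = b i")
      case True
      then have "cylinder n a \<inter> cylinder m b = cylinder m b"
        using that by auto
      then show ?thesis by auto
    next
      case False
      then have "cylinder n a \<inter> cylinder m b = {}"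
        using that by (auto dest: less_le_trans)
      then show ?thesis by simp
    qed
    have *: "cylinder n a \<inter> cylinder m b \<in> ?E" for n m and a b :: "nat \<Rightarrow> 's"
    proof (cases "n \<le> m")
      case False
      then have "cylinder m b \<inter> cylinder n a \<in> ?E"
        by (intro le) simp
      then show ?thesis
        by (simp only: Int_commute)
    qed (rule le)
    fix A B assume "A \<in> ?E" "B \<in> ?E"
    then consider "A \<inter> B = {}" | n a m b where "A = cylinder n a" "B = cylinder m b"
      by auto
    then show "A \<inter> B \<in> ?E"
      by cases (simp_all only: * insertI1)
  qed
  have "cylinder 0 undefined \<in> ?E"
    by auto
  then show "range (\<lambda>_ :: nat. UNIV) \<subseteq> ?E"
    by simp
  show "emeasure \<mu> UNIV \<noteq> \<infinity>"
    using finite_measure.emeasure_finite[OF assms(1)] by simp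
  fix X assume "X \<in> ?E"
  then show "emeasure \<mu> X = emeasure \<nu> X"
    using eq by auto
qed (use assms in \<open>auto simp: sets_seq_space_eq_sigma_sets\<close>)

section \<open>Shifts and the Markov property\<close>

definition shift_seq :: "nat \<Rightarrow> (nat \<Rightarrow> 's) \<Rightarrow> nat \<Rightarrow> 's" where
  "shift_seq m \<omega> = (\<lambda>i. \<omega> (m + i))"

lemma measurable_shift_seq [measurable]: "shift_seq m \<in> seq_space \<rightarrow>\<^sub>M seq_space"
  unfolding shift_seq_def by (rule measurable_PiM_single') auto

lemma measurable_chain_law [simp]: "measurable (chain_law K s) N = measurable seq_space N"
  by (rule measurable_cong_sets) (simp_all add: sets_chain_law)

declare sets_chain_law [simp, measurable_cong] space_chain_law [simp]

text \<open>If \<open>b 0 = a m\<close>, the two words overlap at time \<open>m\<close> and glue to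
  one cylinder \<open>c\<close>, whose transition probabilities split into those of \<open>a\<close>
  and those of \<open>b\<close>. Otherwise, for positive \<open>n\<close>, both sides
  vanish.\<close>

lemma markov_cylinder:
  fixes a b :: "nat \<Rightarrow> 's::countable"
  shows "emeasure (chain_law K x) (cylinder (Suc m) a \<inter> shift_seq m -` cylinder n b) =
    emeasure (chain_law K x) (cylinder (Suc m) a) * emeasure (chain_law K (a m)) (cylinder n b)"
proof (cases n)
  case 0
  then show ?thesis
    using prob_space.emeasure_space_1[OF prob_space_chain_law[of K "a m"]] by simp
next
  case (Suc k)
  show ?thesis
  proof (cases "b 0 = a m")
    case False
    then have "cylinder (Suc m) a \<inter> shift_seq m -` cylinder n b = {}"
      using Suc by (auto simp: shift_seq_def)
    moreover have "emeasure (chain_law K (a m)) (cylinder n b) = 0"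
      using False Suc unfolding emeasure_chain_law_cylinder by (intro prod_zero) auto
    ultimately show ?thesis by simp
  next
    case True
    define c where "c i = (if i \<le> m then a i else b (i - m))" for i
    have "cylinder (Suc m) a \<inter> shift_seq m -` cylinder (Suc k) b = cylinder (Suc m + k) c"
    proof -
      have "(\<forall>i<Suc m. \<omega> i = a i) \<and> (\<forall>i<Suc k. \<omega> (m + i) = b i) \<longleftrightarrow> (\<forall>i<Suc m + k. \<omega> i = c i)" for \<omega>
      proof (intro iffI conjI allI impI)
        fix i assume *: "(\<forall>i<Suc m. \<omega> i = a i) \<and> (\<forall>i<Suc k. \<omega> (m + i) = b i)" "i < Suc m + k"
        show "\<omega> i = c i"
          using conjunct1[OF *(1)] conjunct2[OF *(1), rule_format, of "i - m"] *(2) by (auto simp: c_def)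
      qed (use True in \<open>auto simp: c_def\<close>)
      then show ?thesis
        by (auto simp: shift_seq_def)
    qed
    moreover have "emeasure (chain_law K x) (cylinder (Suc m + k) c) =
        emeasure (chain_law K x) (cylinder (Suc m) a) * emeasure (chain_law K (a m)) (cylinder (Suc k) b)"
    proof (induction k)
      case 0
      have "(\<Prod>i<Suc m. ennreal (pmf (if i = 0 then return_pmf x else K (c (i - 1))) (c i))) =
          (\<Prod>i<Suc m. ennreal (pmf (if i = 0 then return_pmf x else K (a (i - 1))) (a i)))"
        by (intro prod.cong) (auto simp: c_def)
      moreover have "emeasure (chain_law K (a m)) (cylinder (Suc 0) b) = 1"
        by (subst emeasure_chain_law_cylinder) (simp add: True)
      ultimately show ?case
        by (simp only: add_0_right mult_1_right emeasure_chain_law_cylinder[of K x])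
    next
      case (Suc k)
      have "c (m + k) = b k" "c (Suc (m + k)) = b (Suc k)"
        using True by (auto simp: c_def)
      then show ?case
        using Suc.IH unfolding emeasure_chain_law_cylinder
        by (simp add: mult.assoc)
    qed
    ultimately show ?thesis
      using Suc by simp
  qed
qed

text \<open>Both sides integrate \<open>g\<close> against measures on trajectories: the image under
  the shift of the law restricted to the cylinder, and a multiple of the law started at
  \<open>a m\<close>. By \<open>markov_cylinder\<close> they agree on cylinders.\<close>

lemma markov_nn_integral_cylinder:
  fixes a :: "nat \<Rightarrow> 's::countable"
  assumes [measurable]: "g \<in> borel_measurable seq_space"
  shows "(\<integral>\<^sup>+\<omega>. g (shift_seq m \<omega>) * indicator (cylinder (Suc m) a) \<omega> \<partial>chain_law K x) =
    emeasure (chain_law K x) (cylinder (Suc m) a) * (\<integral>\<^sup>+u. g u \<partial>chain_law K (a m))"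
proof -
  interpret P: prob_space "chain_law K x" by (rule prob_space_chain_law)
  define C where "C = cylinder (Suc m) a"
  define \<mu> where "\<mu> = distr (density (chain_law K x) (indicator C)) seq_space (shift_seq m)"
  define \<nu> where "\<nu> = scale_measure (emeasure (chain_law K x) C) (chain_law K (a m))"
  have C [measurable]: "C \<in> sets seq_space"
    unfolding C_def by simp
  have \<mu>: "emeasure \<mu> B = emeasure (chain_law K x) (C \<inter> shift_seq m -` B)" if [measurable]: "B \<in> sets seq_space" for B
  proof -
    have "shift_seq m -` B \<inter> space seq_space \<in> sets seq_space"
      by (rule measurable_sets[OF measurable_shift_seq that])
    then have [measurable]: "shift_seq m -` B \<in> sets seq_space"
      by simp
    have "emeasure \<mu> B = emeasure (density (chain_law K x) (indicator C)) (shift_seq m -` B)"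
      unfolding \<mu>_def by (subst emeasure_distr) auto
    also have "\<dots> = (\<integral>\<^sup>+\<omega>. indicator C \<omega> * indicator (shift_seq m -` B) \<omega> \<partial>chain_law K x)"
      by (rule emeasure_density) auto
    also have "\<dots> = (\<integral>\<^sup>+\<omega>. indicator (C \<inter> shift_seq m -` B) \<omega> \<partial>chain_law K x)"
      by (intro nn_integral_cong) (auto split: split_indicator)
    also have "\<dots> = emeasure (chain_law K x) (C \<inter> shift_seq m -` B)"
      by (rule nn_integral_indicator) auto
    finally show ?thesis .
  qed
  have "\<mu> = \<nu>"
  proof (rule measure_eqI_cylinder)
    show "finite_measure \<mu>"
    proof (rule finite_measureI)
      have "emeasure \<mu> UNIV = emeasure (chain_law K x) C"
        using \<mu>[of UNIV] sets.top[of seq_space] by simp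
      then show "emeasure \<mu> (space \<mu>) \<noteq> \<infinity>"
        by (simp add: \<mu>_def)
    qed
    show "emeasure \<mu> (cylinder n b) = emeasure \<nu> (cylinder n b)" for n b
      using markov_cylinder[where n = n and b = b]
      by (simp add: \<mu> \<nu>_def C_def)
  qed (simp_all add: \<mu>_def \<nu>_def)
  then have "(\<integral>\<^sup>+u. g u \<partial>\<mu>) = emeasure (chain_law K x) C * (\<integral>\<^sup>+u. g u \<partial>chain_law K (a m))"
    by (simp add: \<nu>_def nn_integral_scale_measure)
  moreover have "(\<integral>\<^sup>+u. g u \<partial>\<mu>) = (\<integral>\<^sup>+\<omega>. g (shift_seq m \<omega>) * indicator C \<omega> \<partial>chain_law K x)"
    unfolding \<mu>_def by (subst nn_integral_distr) (auto simp: nn_integral_density mult.commute)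
  ultimately show ?thesis
    by (simp add: C_def)
qed

text \<open>The first argument of \<open>F\<close> carries the past and the second the future.
  Splitting over the countably many prefixes of length \<open>Suc m\<close> freezes the first
  argument and leaves one cylinder at a time.\<close>

lemma markov_property:
  fixes F :: "(nat \<Rightarrow> 's::countable) \<Rightarrow> (nat \<Rightarrow> 's) \<Rightarrow> ennreal"
  assumes meas [measurable]: "\<And>a. F a \<in> borel_measurable seq_space"
    and past: "\<And>a a' u. (\<And>i. i \<le> m \<Longrightarrow> a i = a' i) \<Longrightarrow> F a u = F a' u"
  shows "(\<integral>\<^sup>+\<omega>. F \<omega> (shift_seq m \<omega>) \<partial>chain_law K x) =
    (\<integral>\<^sup>+\<omega>. (\<integral>\<^sup>+u. F \<omega> u \<partial>chain_law K (\<omega> m)) \<partial>chain_law K x)"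
proof -
  define Z where "Z \<omega> = map \<omega> [0..<Suc m]" for \<omega> :: "nat \<Rightarrow> 's"
  have [measurable]: "Z \<in> seq_space \<rightarrow>\<^sub>M count_space UNIV"
    unfolding Z_def by (rule measurable_prefix)
  have Z_nth: "(!) (Z \<omega>) i = \<omega> i" if "i \<le> m" for \<omega> i
    using that unfolding Z_def by (simp del: upt_Suc)
  \<comment> \<open>The prefix, read as a sequence by \<open>(!)\<close>, represents its fibre. Its
    values beyond \<open>m\<close> are unspecified, but \<open>past\<close> shows that
    \<open>F\<close> ignores them.\<close>
  have F_Z: "F ((!) (Z \<omega>)) u = F \<omega> u" for \<omega> u
    by (rule past) (simp add: Z_nth)
  define G where "G \<omega> = (\<integral>\<^sup>+u. F \<omega> u \<partial>chain_law K (\<omega> m))" for \<omega>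
  have G_Z: "G ((!) (Z \<omega>)) = G \<omega>" for \<omega>
    unfolding G_def F_Z by (simp add: Z_nth)
  have fibre: "{\<omega>. Z \<omega> = z} = cylinder (Suc m) ((!) z)" if "length z = Suc m" for z
    using that by (auto simp: Z_def list_eq_iff_nth_eq simp del: upt_Suc)
  have sum: "g (Z \<omega>) \<omega> = (\<integral>\<^sup>+z. g z \<omega> * indicator {\<omega>. Z \<omega> = z} \<omega> \<partial>count_space UNIV)"
    for g :: "'s list \<Rightarrow> (nat \<Rightarrow> 's) \<Rightarrow> ennreal" and \<omega>
  proof -
    have "(\<integral>\<^sup>+z. g z \<omega> * indicator {\<omega>. Z \<omega> = z} \<omega> \<partial>count_space UNIV) =
        (\<integral>\<^sup>+z. g z \<omega> * indicator {Z \<omega>} z \<partial>count_space UNIV)"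
      by (intro nn_integral_cong) (auto split: split_indicator)
    then show ?thesis
      by (simp add: nn_integral_indicator_finite)
  qed
  have fibre_sets [measurable]: "{\<omega>. Z \<omega> = z} \<in> sets seq_space" for z
    using measurable_sets[of Z seq_space "count_space UNIV" "{z}"] by (simp add: vimage_def)
  have "(\<integral>\<^sup>+\<omega>. F \<omega> (shift_seq m \<omega>) \<partial>chain_law K x) =
      (\<integral>\<^sup>+\<omega>. (\<integral>\<^sup>+z. F ((!) z) (shift_seq m \<omega>) * indicator {\<omega>. Z \<omega> = z} \<omega> \<partial>count_space UNIV) \<partial>chain_law K x)"
    by (subst sum[symmetric, where g = "\<lambda>z \<omega>. F ((!) z) (shift_seq m \<omega>)"]) (simp add: F_Z)
  also have "\<dots> = (\<integral>\<^sup>+z. (\<integral>\<^sup>+\<omega>. F ((!) z) (shift_seq m \<omega>) * indicator {\<omega>. Z \<omega> = z} \<omega> \<partial>chain_law K x) \<partial>count_space UNIV)"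
    by (rule nn_integral_count_space_nn_integral) auto
  also have "\<dots> = (\<integral>\<^sup>+z. (\<integral>\<^sup>+\<omega>. G ((!) z) * indicator {\<omega>. Z \<omega> = z} \<omega> \<partial>chain_law K x) \<partial>count_space UNIV)"
  proof (rule nn_integral_cong)
    fix z
    show "(\<integral>\<^sup>+\<omega>. F ((!) z) (shift_seq m \<omega>) * indicator {\<omega>. Z \<omega> = z} \<omega> \<partial>chain_law K x) =
        (\<integral>\<^sup>+\<omega>. G ((!) z) * indicator {\<omega>. Z \<omega> = z} \<omega> \<partial>chain_law K x)"
    proof (cases "length z = Suc m")
      case True
      have "(\<integral>\<^sup>+\<omega>. G ((!) z) * indicator {\<omega>. Z \<omega> = z} \<omega> \<partial>chain_law K x) =
          G ((!) z) * emeasure (chain_law K x) {\<omega>. Z \<omega> = z}"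
        by (intro nn_integral_cmult_indicator) auto
      then show ?thesis
        using True by (simp add: fibre markov_nn_integral_cylinder G_def mult.commute)
    next
      case False
      then have "{\<omega>. Z \<omega> = z} = {}"
        by (auto simp: Z_def)
      then show ?thesis by simp
    qed
  qed
  also have "\<dots> = (\<integral>\<^sup>+\<omega>. (\<integral>\<^sup>+z. G ((!) z) * indicator {\<omega>. Z \<omega> = z} \<omega> \<partial>count_space UNIV) \<partial>chain_law K x)"
    by (rule nn_integral_count_space_nn_integral[symmetric]) auto
  also have "\<dots> = (\<integral>\<^sup>+\<omega>. G \<omega> \<partial>chain_law K x)"
    by (subst sum[symmetric, where g = "\<lambda>z \<omega>. G ((!) z)"]) (simp add: G_Z)
  finally show ?thesis
    by (simp add: G_def)
qed

section \<open>Second moments\<close>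

text \<open>Supplies the finiteness that allows the cancellation in
  \<open>dual_doob\<close>.\<close>

lemma (in prob_space) nn_integral_sum_power2_less_top:
  fixes h :: "'i \<Rightarrow> 'a \<Rightarrow> ennreal"
  assumes "\<And>i \<omega>. h i \<omega> \<le> c" "c \<noteq> \<infinity>"
  shows "(\<integral>\<^sup>+\<omega>. (\<Sum>i\<in>I. h i \<omega>)\<^sup>2 \<partial>M) < \<infinity>"
proof -
  have "(\<Sum>i\<in>I. h i \<omega>)\<^sup>2 \<le> (of_nat (card I) * c)\<^sup>2" for \<omega>
    using assms(1) by (intro power_mono sum_bounded_above) auto
  then have "(\<integral>\<^sup>+\<omega>. (\<Sum>i\<in>I. h i \<omega>)\<^sup>2 \<partial>M) \<le> (\<integral>\<^sup>+\<omega>. (of_nat (card I) * c)\<^sup>2 \<partial>M)"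
    by (intro nn_integral_mono)
  also have "\<dots> = (of_nat (card I) * c)\<^sup>2"
    by (simp add: emeasure_space_1)
  also have "\<dots> < \<infinity>"
    using assms(2) by (auto simp: power2_eq_square ennreal_mult_less_top less_top of_nat_less_top)
  finally show ?thesis .
qed

text \<open>Past and future are independent given the present, so averaging the adapted
  \<open>f m\<close> over \<open>\<omega> m\<close> amounts to conditioning on the whole future from
  time \<open>m\<close>. These future sigma-algebras decrease in \<open>m\<close>, and a single use
  of \<open>dual_doob\<close> suffices.\<close>

lemma second_moment_adapted:
  fixes f :: "nat \<Rightarrow> (nat \<Rightarrow> 's::countable) \<Rightarrow> ennreal" and K :: "'s \<Rightarrow> 's pmf" and x :: 's
  defines "P \<equiv> chain_law K x"
  assumes adapted: "\<And>m a a'. (\<And>i. i \<le> m \<Longrightarrow> a i = a' i) \<Longrightarrow> f m a = f m a'"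
    and bound: "\<And>m a. f m a \<le> c" "c \<noteq> \<infinity>"
  shows "(\<integral>\<^sup>+\<omega>. (\<Sum>m<N. cond_avg P (\<lambda>\<omega>. \<omega> m) (f m) (\<omega> m))\<^sup>2 \<partial>P) \<le> 4 * (\<integral>\<^sup>+\<omega>. (\<Sum>m<N. f m \<omega>)\<^sup>2 \<partial>P)"
proof -
  interpret P: prob_space P
    unfolding P_def by (rule prob_space_chain_law)
  define h where "h m \<omega> = cond_avg P (\<lambda>\<omega>. \<omega> m) (f m) (\<omega> m)" for m \<omega>
  have P_meas [simp]: "measurable P N = measurable seq_space N" for N :: "'z measure"
    by (simp add: P_def)
  have f_meas [measurable]: "f m \<in> borel_measurable seq_space" for m
    by (rule measurable_prefix_determined[of "Suc m"]) (auto intro: adapted)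
  have h_meas [measurable]: "h m \<in> borel_measurable seq_space" for m
    unfolding h_def by measurable
  have h_bound: "h m \<omega> \<le> c" for m \<omega>
    unfolding h_def by (rule P.cond_avg_le) (auto simp: bound)
  have key: "(\<integral>\<^sup>+\<omega>. f i \<omega> * \<psi> (\<omega> j) \<partial>P) = (\<integral>\<^sup>+\<omega>. h i \<omega> * \<psi> (\<omega> j) \<partial>P)" if "i \<le> j" for i j \<psi>
  proof -
    \<comment> \<open>\<open>\<Psi>\<close> carries the test function from time \<open>j\<close>
      back to time \<open>i\<close>. Against a function of \<open>\<omega> i\<close>,
      \<open>f i\<close> may be replaced by its average \<open>h i\<close>, which is itself adapted,
      so the Markov property can be undone afterwards.\<close>
    define \<Psi> where "\<Psi> z = (\<integral>\<^sup>+u. \<psi> (u (j - i)) \<partial>chain_law K z)" for z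
    have markov: "(\<integral>\<^sup>+\<omega>. g \<omega> * \<psi> (\<omega> j) \<partial>P) = (\<integral>\<^sup>+\<omega>. g \<omega> * \<Psi> (\<omega> i) \<partial>P)"
      if g: "\<And>a a'. (\<And>k. k \<le> i \<Longrightarrow> a k = a' k) \<Longrightarrow> g a = g a'" for g
    proof -
      have "(\<integral>\<^sup>+\<omega>. g \<omega> * \<psi> (shift_seq i \<omega> (j - i)) \<partial>P) =
          (\<integral>\<^sup>+\<omega>. (\<integral>\<^sup>+u. g \<omega> * \<psi> (u (j - i)) \<partial>chain_law K (\<omega> i)) \<partial>P)"
        unfolding P_def
      proof (rule markov_property)
        fix a a' u :: "nat \<Rightarrow> 's" assume "\<And>k. k \<le> i \<Longrightarrow> a k = a' k"
        then have "g a = g a'" by (rule g)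
        then show "g a * \<psi> (u (j - i)) = g a' * \<psi> (u (j - i))" by simp
      qed auto
      then show ?thesis
        using \<open>i \<le> j\<close> by (simp add: shift_seq_def \<Psi>_def nn_integral_cmult)
    qed
    have "(\<integral>\<^sup>+\<omega>. f i \<omega> * \<psi> (\<omega> j) \<partial>P) = (\<integral>\<^sup>+\<omega>. f i \<omega> * \<Psi> (\<omega> i) \<partial>P)"
      by (rule markov) (rule adapted)
    also have "\<dots> = (\<integral>\<^sup>+\<omega>. h i \<omega> * \<Psi> (\<omega> i) \<partial>P)"
      unfolding h_def by (rule P.nn_integral_cond_avg[symmetric]) auto
    also have "\<dots> = (\<integral>\<^sup>+\<omega>. h i \<omega> * \<psi> (\<omega> j) \<partial>P)"
      by (rule markov[symmetric]) (simp add: h_def)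
    finally show ?thesis .
  qed
  have "(\<integral>\<^sup>+\<omega>. (\<Sum>m<N. h m \<omega>)\<^sup>2 \<partial>P) \<le> 4 * (\<integral>\<^sup>+\<omega>. (\<Sum>m<N. f m \<omega>)\<^sup>2 \<partial>P)"
  proof (rule dual_doob)
    show "(\<integral>\<^sup>+\<omega>. (\<Sum>m<N. h m \<omega>)\<^sup>2 \<partial>P) < \<infinity>"
      using h_bound bound(2) by (rule P.nn_integral_sum_power2_less_top)
    fix i j
    show "(\<integral>\<^sup>+\<omega>. h i \<omega> * h j \<omega> \<partial>P) \<le> (\<integral>\<^sup>+\<omega>. h i \<omega> * f j \<omega> \<partial>P) + (\<integral>\<^sup>+\<omega>. f i \<omega> * h j \<omega> \<partial>P)"
    proof (cases "i \<le> j")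
      case True
      then have "(\<integral>\<^sup>+\<omega>. h i \<omega> * h j \<omega> \<partial>P) = (\<integral>\<^sup>+\<omega>. f i \<omega> * h j \<omega> \<partial>P)"
        using key[of i j "cond_avg P (\<lambda>\<omega>. \<omega> j) (f j)"] by (simp add: h_def)
      then show ?thesis by simp
    next
      case False
      then have "(\<integral>\<^sup>+\<omega>. h i \<omega> * h j \<omega> \<partial>P) = (\<integral>\<^sup>+\<omega>. h i \<omega> * f j \<omega> \<partial>P)"
        using key[of j i "cond_avg P (\<lambda>\<omega>. \<omega> i) (f i)"] by (simp add: h_def mult.commute)
      then show ?thesis by simp
    qed
  qed auto
  then show ?thesis
    by (simp add: h_def)
qed

text \<open>Conditioning on the past up to \<open>n\<close> costs a factor 4 by
  \<open>dual_doob\<close>, since the pasts increase. The result \<open>f n\<close> is adapted, so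
  averaging it over \<open>\<omega> n\<close> costs another 4 by
  \<open>second_moment_adapted\<close>.\<close>

lemma second_moment:
  fixes g :: "nat \<Rightarrow> (nat \<Rightarrow> 's::countable) \<Rightarrow> ennreal" and K :: "'s \<Rightarrow> 's pmf" and x :: 's
  defines "P \<equiv> chain_law K x"
  assumes [measurable]: "\<And>n. g n \<in> borel_measurable seq_space"
    and bound: "\<And>m a. g m a \<le> c" "c \<noteq> \<infinity>"
  shows "(\<integral>\<^sup>+\<omega>. (\<Sum>n<N. cond_avg P (\<lambda>\<omega>. \<omega> n) (g n) (\<omega> n))\<^sup>2 \<partial>P) \<le> 16 * (\<integral>\<^sup>+\<omega>. (\<Sum>n<N. g n \<omega>)\<^sup>2 \<partial>P)"
proof -
  interpret P: prob_space P
    unfolding P_def by (rule prob_space_chain_law)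
  have P_meas [simp]: "measurable P N = measurable seq_space N" for N :: "'z measure"
    by (simp add: P_def)
  define Z where "Z n \<omega> = map \<omega> [0..<Suc n]" for n and \<omega> :: "nat \<Rightarrow> 's"
  have [measurable]: "Z n \<in> seq_space \<rightarrow>\<^sub>M count_space UNIV" for n
    unfolding Z_def by (rule measurable_prefix)
  have Z_nth: "Z n \<omega> ! i = \<omega> i" if "i \<le> n" for n i \<omega>
    using that by (simp add: Z_def del: upt_Suc)
  have Z_take: "take (Suc i) (Z j \<omega>) = Z i \<omega>" if "i \<le> j" for i j \<omega>
    using that by (simp add: Z_def take_map del: upt_Suc)
  define f where "f n \<omega> = cond_avg P (Z n) (g n) (Z n \<omega>)" for n \<omega>
  have f_bound: "f n \<omega> \<le> c" for n \<omega>
    unfolding f_def by (rule P.cond_avg_le) (auto simp: bound)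
  have f_meas [measurable]: "f n \<in> borel_measurable seq_space" for n
    unfolding f_def by measurable
  have f: "(\<integral>\<^sup>+\<omega>. f n \<omega> * \<phi> (Z n \<omega>) \<partial>P) = (\<integral>\<^sup>+\<omega>. g n \<omega> * \<phi> (Z n \<omega>) \<partial>P)" for n \<phi>
    unfolding f_def by (rule P.nn_integral_cond_avg) auto
  \<comment> \<open>Tower property: the present \<open>\<omega> n\<close> is the last entry of the
    prefix \<open>Z n \<omega>\<close>.\<close>
  have "cond_avg P (\<lambda>\<omega>. \<omega> n) (f n) z = cond_avg P (\<lambda>\<omega>. \<omega> n) (g n) z" for n z
    using f[of n "\<lambda>l. indicator {z} (l ! n)"] by (simp add: cond_avg_def Z_nth)
  then have "(\<integral>\<^sup>+\<omega>. (\<Sum>n<N. cond_avg P (\<lambda>\<omega>. \<omega> n) (g n) (\<omega> n))\<^sup>2 \<partial>P) =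
      (\<integral>\<^sup>+\<omega>. (\<Sum>n<N. cond_avg P (\<lambda>\<omega>. \<omega> n) (f n) (\<omega> n))\<^sup>2 \<partial>P)"
    by simp
  also have "\<dots> \<le> 4 * (\<integral>\<^sup>+\<omega>. (\<Sum>n<N. f n \<omega>)\<^sup>2 \<partial>P)"
    unfolding P_def
  proof (rule second_moment_adapted[OF _ f_bound bound(2)])
    fix m and a a' :: "nat \<Rightarrow> 's" assume "\<And>i. i \<le> m \<Longrightarrow> a i = a' i"
    then have "Z m a = Z m a'"
      by (auto simp: Z_def simp del: upt_Suc)
    then show "f m a = f m a'"
      by (simp add: f_def)
  qed
  also have "(\<integral>\<^sup>+\<omega>. (\<Sum>n<N. f n \<omega>)\<^sup>2 \<partial>P) \<le> 4 * (\<integral>\<^sup>+\<omega>. (\<Sum>n<N. g n \<omega>)\<^sup>2 \<partial>P)"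
  proof (rule dual_doob)
    show "(\<integral>\<^sup>+\<omega>. (\<Sum>n<N. f n \<omega>)\<^sup>2 \<partial>P) < \<infinity>"
      using f_bound bound(2) by (rule P.nn_integral_sum_power2_less_top)
    \<comment> \<open>For \<open>i \<le> j\<close>, \<open>f i\<close> is a function of the longer
      prefix \<open>Z j\<close>, by truncation, and so is an admissible test function for
      \<open>f j\<close>.\<close>
    have le: "(\<integral>\<^sup>+\<omega>. f j \<omega> * f i \<omega> \<partial>P) = (\<integral>\<^sup>+\<omega>. g j \<omega> * f i \<omega> \<partial>P)" if "i \<le> j" for i j
      using f[of j "\<lambda>l. cond_avg P (Z i) (g i) (take (Suc i) l)"]
      unfolding Z_take[OF that] f_def[of i, symmetric] .
    fix i j
    show "(\<integral>\<^sup>+\<omega>. f i \<omega> * f j \<omega> \<partial>P) \<le> (\<integral>\<^sup>+\<omega>. f i \<omega> * g j \<omega> \<partial>P) + (\<integral>\<^sup>+\<omega>. g i \<omega> * f j \<omega> \<partial>P)"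
    proof (cases "i \<le> j")
      case True
      then show ?thesis
        using le[of i j] by (simp add: mult.commute)
    next
      case False
      then show ?thesis
        using le[of j i] by simp
    qed
  qed auto
  then have "4 * (\<integral>\<^sup>+\<omega>. (\<Sum>n<N. f n \<omega>)\<^sup>2 \<partial>P) \<le> 16 * (\<integral>\<^sup>+\<omega>. (\<Sum>n<N. g n \<omega>)\<^sup>2 \<partial>P)"
    using mult_left_mono[of _ _ "4 :: ennreal"] by (fastforce simp: mult.assoc[symmetric])
  finally show ?thesis .
qed

section \<open>Loop-erasure of a prefix\<close>

text \<open>
  The loop-erasure of \<open>a 0, \<dots>, a m\<close>, continued by the constant value \<open>a m\<close> once it has reached
  its last element; this is the effect of the minimum.
\<close>

primrec prefix_loop_erasure :: "nat \<Rightarrow> (nat \<Rightarrow> 's) \<Rightarrow> nat \<Rightarrow> 's" where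
  "prefix_loop_erasure m a 0 = a 0"
| "prefix_loop_erasure m a (Suc k) =
    a (min m (Suc (GREATEST i. i \<le> m \<and> a i = prefix_loop_erasure m a k)))"

text \<open>Position is counted along \<open>l\<close>, not in the time of \<open>u\<close>. In
  \<open>loop_erasure_meets\<close> both futures start at a point of the erased prefix, so there the
  least index is attained.\<close>

definition hit_index :: "(nat \<Rightarrow> 's) \<Rightarrow> (nat \<Rightarrow> 's) \<Rightarrow> nat" where
  "hit_index l u = (LEAST k. l k \<in> range u)"

lemma prefix_loop_erasure_cong:
  assumes "\<And>i. i \<le> m \<Longrightarrow> a i = a' i"
  shows "prefix_loop_erasure m a = prefix_loop_erasure m a'"
proof
  fix k
  show "prefix_loop_erasure m a k = prefix_loop_erasure m a' k"
  proof (induction k)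
    case (Suc k)
    have "(\<lambda>i. i \<le> m \<and> a i = prefix_loop_erasure m a k) = (\<lambda>i. i \<le> m \<and> a' i = prefix_loop_erasure m a' k)"
      using assms Suc.IH by auto
    then show ?case
      using assms by simp
  qed (simp add: assms)
qed

text \<open>Ensures that the \<open>GREATEST\<close> in the recursion always ranges over a nonempty
  set.\<close>

lemma prefix_loop_erasure_in_prefix: "\<exists>i\<le>m. a i = prefix_loop_erasure m a k"
proof (cases k)
  case 0
  then show ?thesis by (intro exI[of _ 0]) simp
next
  case (Suc j)
  then show ?thesis
    unfolding Suc prefix_loop_erasure.simps by (blast intro: min.cobounded1)
qed

lemma last_index_upto:
  fixes a :: "nat \<Rightarrow> 's"
  assumes "\<exists>i\<le>m. a i = u"
  defines "t \<equiv> GREATEST i. i \<le> m \<and> a i = u"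
  shows "t \<le> m" "a t = u" "\<And>i. i \<le> m \<Longrightarrow> a i = u \<Longrightarrow> i \<le> t"
proof -
  have "t \<le> m \<and> a t = u"
    unfolding t_def using GreatestI_ex_nat[of "\<lambda>i. i \<le> m \<and> a i = u" m] assms(1) by blast
  then show "t \<le> m" "a t = u"
    by auto
  show "i \<le> t" if "i \<le> m" "a i = u" for i
    unfolding t_def using Greatest_le_nat[of "\<lambda>i. i \<le> m \<and> a i = u" i m] that by blast
qed

text \<open>As long as the end is not reached, the last visit times \<open>t k\<close> stay below
  \<open>m\<close> and strictly increase, so \<open>k \<le> t k < m\<close>, which fails at
  \<open>k = m\<close>.\<close>

lemma prefix_loop_erasure_reaches_end: "\<exists>k. prefix_loop_erasure m a k = a m"
proof (rule ccontr)
  assume "\<nexists>k. prefix_loop_erasure m a k = a m"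
  then have ne: "prefix_loop_erasure m a k \<noteq> a m" for k
    by auto
  define t where "t k = (GREATEST i. i \<le> m \<and> a i = prefix_loop_erasure m a k)" for k
  note t = last_index_upto[OF prefix_loop_erasure_in_prefix[of m a], folded t_def]
  have lt: "t k < m" for k
    using t(1)[of k] t(2)[of k] ne[of k] by (metis nat_less_le)
  have "Suc (t k) \<le> t (Suc k)" for k
    by (rule t(3)) (use lt[of k] in \<open>auto simp: t_def[of k]\<close>)
  then have "k \<le> t k" for k
    by (induction k) (auto intro: order_trans)
  then show False
    using lt[of m] by (meson leD)
qed

text \<open>A point that is not visited from time \<open>m\<close> on has the same last visit in the
  path as in its prefix, so both recursions take the same step. Position \<open>k\<close> depends
  only on the points strictly before it; it may itself be the first one that the future
  hits.\<close>

lemma loop_erasure_eq_prefix_loop_erasure: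
  assumes "\<And>i. i < k \<Longrightarrow> prefix_loop_erasure m a i \<notin> range (shift_seq m a)"
  shows "loop_erasure a k = prefix_loop_erasure m a k"
  using assms
proof (induction k)
  case (Suc k)
  define u where "u = prefix_loop_erasure m a k"
  have u: "loop_erasure a k = u"
    unfolding u_def by (rule Suc.IH) (simp add: Suc.prems)
  have *: "a i \<noteq> u" if "m \<le> i" for i
    using Suc.prems[of k] that unfolding u_def shift_seq_def
    by (metis le_add_diff_inverse lessI rangeI)
  define t where "t = (GREATEST i. i \<le> m \<and> a i = u)"
  note t = last_index_upto[OF prefix_loop_erasure_in_prefix[of m a k], folded u_def, folded t_def]
  have "(\<lambda>i. a i = u) = (\<lambda>i. i \<le> m \<and> a i = u)"
    using * by (metis nle_le)
  then have "last_visit a u = t"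
    by (simp add: last_visit_def t_def)
  \<comment> \<open>Strictness makes the \<open>min\<close> in \<open>prefix_loop_erasure\<close>
    inactive.\<close>
  moreover have "t < m"
    using t(1,2) *[of t] by (metis nle_le nat_less_le)
  ultimately show ?case
    by (simp add: u u_def[symmetric] t_def[symmetric])
qed simp

text \<open>The future of \<open>a\<close> misses all points of the erased prefix before the first
  one hit by the future of \<open>b\<close>. That point therefore lies on the loop-erasure of the
  whole path.\<close>

lemma loop_erasure_meets:
  assumes "a m = b n"
    and le: "hit_index (prefix_loop_erasure m a) (shift_seq n b) \<le> hit_index (prefix_loop_erasure m a) (shift_seq m a)"
  shows "\<exists>i j. loop_erasure a i = b j"
proof -
  define L where "L = prefix_loop_erasure m a"
  define i where "i = hit_index L (shift_seq n b)"
  obtain k where "L k = a m"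
    using prefix_loop_erasure_reaches_end unfolding L_def by metis
  then have "L k = shift_seq n b 0"
    using assms(1) by (simp add: shift_seq_def)
  then have "L k \<in> range (shift_seq n b)"
    by simp
  then have "L i \<in> range (shift_seq n b)"
    unfolding i_def hit_index_def by (rule LeastI)
  moreover have "L j \<notin> range (shift_seq m a)" if "j < i" for j
    using that le unfolding i_def L_def hit_index_def by (intro not_less_Least) auto
  then have "loop_erasure a i = L i"
    unfolding L_def by (rule loop_erasure_eq_prefix_loop_erasure)
  ultimately show ?thesis
    unfolding shift_seq_def by fastforce
qed

section \<open>Measurability of the loop-erasure and of hitting positions\<close>

lemma measurable_last_visit:
  fixes u :: "'s::countable"
  shows "(\<lambda>\<omega>. last_visit \<omega> u) \<in> seq_space \<rightarrow>\<^sub>M count_space UNIV"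
proof -
  define Q where "Q \<omega> k \<longleftrightarrow> \<omega> k = u \<and> (\<forall>i. \<omega> i = u \<longrightarrow> i \<le> k)" for \<omega> :: "nat \<Rightarrow> 's" and k
  \<comment> \<open>\<open>Q \<omega> k\<close> says that \<open>k\<close> is the last visit to
    \<open>u\<close>. If there is none, \<open>GREATEST\<close>, being a definite description,
    returns the same number \<open>THE k. False\<close> for every such path.\<close>
  have eq: "last_visit \<omega> u = r \<longleftrightarrow> Q \<omega> r \<or> (\<forall>k. \<not> Q \<omega> k) \<and> r = (THE k. False)" for \<omega> r
  proof (cases "\<exists>k. Q \<omega> k")
    case True
    then obtain k where k: "Q \<omega> k" by auto
    have uniq: "j = k" if "Q \<omega> j" for j
      using that k by (auto simp: Q_def intro: le_antisym)
    have "last_visit \<omega> u = k"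
      unfolding last_visit_def using k unfolding Q_def by (intro Greatest_equality) blast+
    then show ?thesis
      using k uniq by metis
  next
    case False
    then have "Q \<omega> = (\<lambda>k. False)"
      by auto
    moreover have "last_visit \<omega> u = (THE k. Q \<omega> k)"
      unfolding last_visit_def Greatest_def Q_def by simp
    ultimately show ?thesis
      using False by auto
  qed
  have [measurable]: "Measurable.pred seq_space (\<lambda>\<omega>. Q \<omega> k)" for k
    unfolding Q_def by measurable
  have "{\<omega> \<in> space seq_space. last_visit \<omega> u = r} \<in> sets seq_space" for r
    unfolding eq by measurable
  then show ?thesis
    by (simp add: measurable_count_space_eq2_countable vimage_def)
qed

lemma measurable_loop_erasure [measurable]:
  "(\<lambda>\<omega> :: nat \<Rightarrow> 's::countable. loop_erasure \<omega> j) \<in> seq_space \<rightarrow>\<^sub>M count_space UNIV"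
proof (induction j)
  case (Suc j)
  have "(\<lambda>\<omega> :: nat \<Rightarrow> 's. last_visit \<omega> (loop_erasure \<omega> j)) \<in> seq_space \<rightarrow>\<^sub>M count_space UNIV"
    using measurable_compose_countable[where f = "\<lambda>u \<omega>. last_visit \<omega> u", OF measurable_last_visit Suc] .
  from measurable_compose_countable[where f = "\<lambda>k \<omega>. \<omega> (Suc k)", OF measurable_seq_nth this]
  show ?case by simp
qed simp

lemma measurable_hit_index [measurable]:
  fixes l :: "nat \<Rightarrow> 's::countable"
  shows "hit_index l \<in> seq_space \<rightarrow>\<^sub>M count_space UNIV"
proof -
  have [measurable]: "Measurable.pred seq_space (\<lambda>u. \<exists>i. l k = u i)" for k
    by measurable
  have "(\<lambda>u. LEAST k. \<exists>i. l k = u i) \<in> seq_space \<rightarrow>\<^sub>M count_space UNIV"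
    by measurable
  then show ?thesis
    by (simp add: hit_index_def[abs_def] image_iff)
qed

section \<open>Two independent chains\<close>

lemma measurable_pred_eq_countable:
  fixes f g :: "'a \<Rightarrow> 'c::countable"
  assumes [measurable]: "f \<in> M \<rightarrow>\<^sub>M count_space UNIV" "g \<in> M \<rightarrow>\<^sub>M count_space UNIV"
  shows "Measurable.pred M (\<lambda>x. f x = g x)"
proof -
  have "Measurable.pred M (\<lambda>x. \<exists>c. f x = c \<and> g x = c)"
    by measurable
  then show ?thesis by simp
qed

text \<open>For two independent copies of \<open>X\<close> at least one of the two comparisons
  holds, and exchanging the copies shows that both have the same probability.\<close>

lemma (in prob_space) nn_integral_le_symmetric:
  fixes X :: "'a \<Rightarrow> nat"
  assumes [measurable]: "X \<in> M \<rightarrow>\<^sub>M count_space UNIV"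
  shows "1 \<le> 2 * (\<integral>\<^sup>+u. (\<integral>\<^sup>+v. (if X v \<le> X u then 1 else 0) \<partial>M) \<partial>M)"
proof -
  interpret MM: pair_sigma_finite M M ..
  have swap: "(\<integral>\<^sup>+u. (\<integral>\<^sup>+v. (if X v \<le> X u then 1 else 0) \<partial>M) \<partial>M) =
      (\<integral>\<^sup>+v. (\<integral>\<^sup>+u. (if X v \<le> X u then 1 else 0 :: ennreal) \<partial>M) \<partial>M)"
    by (rule MM.Fubini'[symmetric]) measurable
  have "1 = (\<integral>\<^sup>+u. (\<integral>\<^sup>+v. 1 \<partial>M) \<partial>M)"
    by (simp add: emeasure_space_1)
  also have "\<dots> \<le> (\<integral>\<^sup>+u. (\<integral>\<^sup>+v. (if X v \<le> X u then 1 else 0) + (if X u \<le> X v then 1 else 0) \<partial>M) \<partial>M)"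
    by (intro nn_integral_mono) auto
  also have "\<dots> = (\<integral>\<^sup>+u. (\<integral>\<^sup>+v. (if X v \<le> X u then 1 else 0) \<partial>M) \<partial>M) +
      (\<integral>\<^sup>+u. (\<integral>\<^sup>+v. (if X u \<le> X v then 1 else 0) \<partial>M) \<partial>M)"
    by (simp add: nn_integral_add)
  also have "\<dots> = 2 * (\<integral>\<^sup>+u. (\<integral>\<^sup>+v. (if X v \<le> X u then 1 else 0) \<partial>M) \<partial>M)"
    by (simp add: swap mult_2)
  finally show ?thesis .
qed

text \<open>
  The lexicographic order makes the indicator of \<open>first_meeting N m n\<close> adapted in the first path, so
  that the factor \<open>4\<close> of \<open>second_moment_adapted\<close> is available there instead of \<open>16\<close>.
\<close>

definition first_meeting :: "nat \<Rightarrow> nat \<Rightarrow> nat \<Rightarrow> (nat \<Rightarrow> 's) \<Rightarrow> (nat \<Rightarrow> 's) \<Rightarrow> bool" where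
  "first_meeting N m n a b \<longleftrightarrow> m < N \<and> n < N \<and> a m = b n \<and>
    (\<forall>i<m. \<forall>j<N. a i \<noteq> b j) \<and> (\<forall>j<n. a m \<noteq> b j)"

text \<open>If the paths meet below \<open>N\<close>, exactly one pair of times is lexicographically
  first.\<close>

lemma sum_first_meeting:
  "(\<Sum>m<N. \<Sum>n<N. if first_meeting N m n a b then 1 else 0 :: ennreal) =
    (if \<exists>m<N. \<exists>n<N. a m = b n then 1 else 0)"
proof (cases "\<exists>m<N. \<exists>n<N. a m = b n")
  case True
  define m where "m = (LEAST m. m < N \<and> (\<exists>n<N. a m = b n))"
  define n where "n = (LEAST n. n < N \<and> a m = b n)"
  have m: "m < N" "\<exists>n<N. a m = b n"
    using LeastI_ex[of "\<lambda>m. m < N \<and> (\<exists>n<N. a m = b n)"] True unfolding m_def by blast+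
  have m_min: "\<forall>j<N. a i \<noteq> b j" if "i < m" for i
    using not_less_Least[of i "\<lambda>m. m < N \<and> (\<exists>n<N. a m = b n)"] that m(1) unfolding m_def[symmetric] by auto
  have n: "n < N" "a m = b n"
    using LeastI_ex[of "\<lambda>n. n < N \<and> a m = b n"] m(2) unfolding n_def by blast+
  have n_min: "a m \<noteq> b j" if "j < n" for j
    using not_less_Least[of j "\<lambda>n. n < N \<and> a m = b n"] that n(1) unfolding n_def[symmetric] by auto
  have "first_meeting N i j a b \<longleftrightarrow> i = m \<and> j = n" for i j
  proof
    assume ij: "first_meeting N i j a b"
    have "i = m"
      using ij m n m_min[of i] unfolding first_meeting_def by (metis linorder_neqE_nat)
    then show "i = m \<and> j = n"
      using ij n n_min[of j] unfolding first_meeting_def by (metis linorder_neqE_nat)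
  qed (use m n m_min n_min in \<open>auto simp: first_meeting_def\<close>)
  then have "(\<Sum>i<N. \<Sum>j<N. if first_meeting N i j a b then 1 else 0 :: ennreal) =
      (\<Sum>i<N. \<Sum>j<N. if i = m then if j = n then 1 else 0 else 0)"
    by (intro sum.cong) auto
  also have "\<dots> = (\<Sum>i<N. if i = m then 1 else 0)"
    using n(1) by (intro sum.cong) (auto simp: sum.delta)
  also have "\<dots> = 1"
    using m(1) by simp
  finally show ?thesis
    using True by simp
next
  case False
  then have "\<not> first_meeting N m n a b" for m n
    by (auto simp: first_meeting_def)
  then show ?thesis
    using False by simp
qed

text \<open>The horizon \<open>N\<close> keeps all sums finite; it is removed in
  \<open>chain_law_loop_erasure_intersection\<close>.\<close>

locale two_chains =
  fixes K :: "'s::countable \<Rightarrow> 's pmf" and x y :: 's and N :: nat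
begin

abbreviation "P \<equiv> chain_law K x"
abbreviation "Q \<equiv> chain_law K y"

sublocale P: prob_space P by (rule prob_space_chain_law)
sublocale Q: prob_space Q by (rule prob_space_chain_law)
sublocale QP: pair_sigma_finite Q P ..

definition meet :: "nat \<Rightarrow> nat \<Rightarrow> (nat \<Rightarrow> 's) \<Rightarrow> (nat \<Rightarrow> 's) \<Rightarrow> ennreal" where
  "meet m n a b = (if first_meeting N m n a b then 1 else 0)"

text \<open>Conditioning is done one path at a time, so that the second moment bounds for a single
  chain apply; here the second path \<open>b\<close> is still frozen.\<close>

definition meet_avg1 :: "nat \<Rightarrow> nat \<Rightarrow> 's \<Rightarrow> (nat \<Rightarrow> 's) \<Rightarrow> ennreal" where
  "meet_avg1 m n z b = cond_avg P (\<lambda>a. a m) (\<lambda>a. meet m n a b) z"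

text \<open>For independent paths and values \<open>z\<close>, \<open>w\<close> of positive
  probability, this is the conditional probability that \<open>(m, n)\<close> is the first meeting
  given \<open>a m = z\<close> and \<open>b n = w\<close>.\<close>

definition meet_avg :: "nat \<Rightarrow> nat \<Rightarrow> 's \<Rightarrow> 's \<Rightarrow> ennreal" where
  "meet_avg m n z w = cond_avg Q (\<lambda>b. b n) (meet_avg1 m n z) w"

lemma meet_adapted: "(\<And>i. i \<le> m \<Longrightarrow> a i = a' i) \<Longrightarrow> meet m n a b = meet m n a' b"
  by (simp add: meet_def first_meeting_def)

lemma meet_cong2:
  assumes "\<And>i. i < N \<Longrightarrow> b i = b' i"
  shows "meet m n a b = meet m n a b'"
proof -
  have "first_meeting N m n a b = first_meeting N m n a b'"
    using assms unfolding first_meeting_def by (auto dest: less_trans)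
  then show ?thesis
    by (simp add: meet_def)
qed

lemma meet_measurable1 [measurable]: "(\<lambda>a. meet m n a b) \<in> borel_measurable seq_space"
  by (rule measurable_prefix_determined[of "Suc m"]) (auto intro: meet_adapted)

lemma meet_avg1_measurable [measurable]: "meet_avg1 m n z \<in> borel_measurable seq_space"
proof (rule measurable_prefix_determined[of N])
  fix b b' :: "nat \<Rightarrow> 's" assume "\<And>i. i < N \<Longrightarrow> b i = b' i"
  then have "meet m n a b = meet m n a b'" for a
    by (rule meet_cong2)
  then show "meet_avg1 m n z b = meet_avg1 m n z b'"
    by (simp add: meet_avg1_def)
qed simp

lemma meet_measurable [measurable]:
  "(\<lambda>p. meet m n (snd p) (fst p)) \<in> borel_measurable (seq_space \<Otimes>\<^sub>M seq_space)"
proof -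
  have [measurable]: "Measurable.pred (seq_space \<Otimes>\<^sub>M seq_space) (\<lambda>p. snd p i = (fst p j :: 's))" for i j
    by (rule measurable_pred_eq_countable) measurable
  show ?thesis
    unfolding meet_def first_meeting_def by measurable
qed

lemma meet_avg1_measurable2 [measurable]:
  "(\<lambda>p. meet_avg1 m n (snd p m) (fst p)) \<in> borel_measurable (seq_space \<Otimes>\<^sub>M seq_space)"
proof -
  have "(\<lambda>p. meet_avg1 m n z (fst p)) \<in> borel_measurable (seq_space \<Otimes>\<^sub>M (seq_space :: (nat \<Rightarrow> 's) measure))" for z
    by measurable
  moreover have "(\<lambda>p. snd p m) \<in> seq_space \<Otimes>\<^sub>M seq_space \<rightarrow>\<^sub>M (count_space UNIV :: 's measure)"
    by measurable
  ultimately show ?thesis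
    by (rule measurable_compose_countable[where f = "\<lambda>z p. meet_avg1 m n z (fst p)"])
qed

lemma meet_le_1: "meet m n a b \<le> 1"
  by (simp add: meet_def)

lemma meet_avg1_le_1: "meet_avg1 m n z b \<le> 1"
  unfolding meet_avg1_def by (rule P.cond_avg_le) (auto simp: meet_le_1)

lemma weight_measurable [measurable]:
  fixes \<phi> :: "'s \<Rightarrow> 's \<Rightarrow> ennreal"
  shows "(\<lambda>p. \<phi> (snd p m) (fst p n)) \<in> borel_measurable (seq_space \<Otimes>\<^sub>M seq_space)"
proof -
  have "(\<lambda>p. fst p n) \<in> (seq_space :: (nat \<Rightarrow> 's) measure) \<Otimes>\<^sub>M (seq_space :: (nat \<Rightarrow> 's) measure) \<rightarrow>\<^sub>M count_space UNIV"
    by measurable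
  then have "(\<lambda>p. \<phi> z (fst p n)) \<in> borel_measurable (seq_space \<Otimes>\<^sub>M (seq_space :: (nat \<Rightarrow> 's) measure))" for z
    by (rule measurable_compose[where g = "\<phi> z"]) simp
  moreover have "(\<lambda>p. snd p m) \<in> seq_space \<Otimes>\<^sub>M seq_space \<rightarrow>\<^sub>M (count_space UNIV :: 's measure)"
    by measurable
  ultimately show ?thesis
    by (rule measurable_compose_countable[where f = "\<lambda>z p. \<phi> z (fst p n)"])
qed

lemma sets_QP [simp]: "measurable (Q \<Otimes>\<^sub>M P) L = measurable (seq_space \<Otimes>\<^sub>M seq_space) L"
  by (intro measurable_cong_sets sets_pair_measure_cong) simp_all

text \<open>The characteristic property of conditioning on the pair \<open>(a m, b n)\<close>: the
  two averages are removed one after the other, with Fubini in between.\<close>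

lemma nn_integral_meet_avg:
  "(\<integral>\<^sup>+a. (\<integral>\<^sup>+b. meet_avg m n (a m) (b n) * \<phi> (a m) (b n) \<partial>Q) \<partial>P) =
   (\<integral>\<^sup>+a. (\<integral>\<^sup>+b. meet m n a b * \<phi> (a m) (b n) \<partial>Q) \<partial>P)"
proof -
  have "(\<integral>\<^sup>+a. (\<integral>\<^sup>+b. meet_avg m n (a m) (b n) * \<phi> (a m) (b n) \<partial>Q) \<partial>P) =
      (\<integral>\<^sup>+a. (\<integral>\<^sup>+b. meet_avg1 m n (a m) b * \<phi> (a m) (b n) \<partial>Q) \<partial>P)"
    unfolding meet_avg_def
    by (intro nn_integral_cong Q.nn_integral_cond_avg) auto
  also have "\<dots> = (\<integral>\<^sup>+b. (\<integral>\<^sup>+a. meet_avg1 m n (a m) b * \<phi> (a m) (b n) \<partial>P) \<partial>Q)"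
    using QP.Fubini'[of "\<lambda>b a. meet_avg1 m n (a m) b * \<phi> (a m) (b n)"]
    by (simp add: split_beta')
  also have "\<dots> = (\<integral>\<^sup>+b. (\<integral>\<^sup>+a. meet m n a b * \<phi> (a m) (b n) \<partial>P) \<partial>Q)"
  proof (rule nn_integral_cong)
    fix b
    show "(\<integral>\<^sup>+a. meet_avg1 m n (a m) b * \<phi> (a m) (b n) \<partial>P) = (\<integral>\<^sup>+a. meet m n a b * \<phi> (a m) (b n) \<partial>P)"
      unfolding meet_avg1_def
      by (rule P.nn_integral_cond_avg[where Z = "\<lambda>a. a m" and \<phi> = "\<lambda>z. \<phi> z (b n)"]) auto
  qed
  also have "\<dots> = (\<integral>\<^sup>+a. (\<integral>\<^sup>+b. meet m n a b * \<phi> (a m) (b n) \<partial>Q) \<partial>P)"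
    using QP.Fubini'[of "\<lambda>b a. meet m n a b * \<phi> (a m) (b n)"]
    by (simp add: split_beta')
  finally show ?thesis .
qed

text \<open>The constant is 16 times 4. At fixed \<open>a\<close> the average over \<open>b\<close>
  uses \<open>second_moment\<close>, as the summands look at all of \<open>b\<close> up to the
  horizon. At fixed \<open>b\<close> the summands are adapted in \<open>a\<close>, and
  \<open>second_moment_adapted\<close> applies.\<close>

lemma second_moment_meet_avg:
  "(\<integral>\<^sup>+a. (\<integral>\<^sup>+b. (\<Sum>m<N. \<Sum>n<N. meet_avg m n (a m) (b n))\<^sup>2 \<partial>Q) \<partial>P) \<le>
   64 * (\<integral>\<^sup>+a. (\<integral>\<^sup>+b. (\<Sum>m<N. \<Sum>n<N. meet m n a b)\<^sup>2 \<partial>Q) \<partial>P)"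
proof -
  have sum_le: "(\<Sum>i<N. u i) \<le> of_nat N" if "\<And>i. u i \<le> 1" for u :: "nat \<Rightarrow> ennreal"
    using sum_bounded_above[of "{..<N}" u 1] that by simp
  have 1: "(\<integral>\<^sup>+b. (\<Sum>m<N. \<Sum>n<N. meet_avg m n (a m) (b n))\<^sup>2 \<partial>Q) \<le>
      16 * (\<integral>\<^sup>+b. (\<Sum>m<N. \<Sum>n<N. meet_avg1 m n (a m) b)\<^sup>2 \<partial>Q)" for a
  proof -
    have "cond_avg Q (\<lambda>b. b n) (\<lambda>b. \<Sum>m<N. meet_avg1 m n (a m) b) w = (\<Sum>m<N. meet_avg m n (a m) w)" for n w
      unfolding meet_avg_def by (rule cond_avg_sum) auto
    moreover have "(\<integral>\<^sup>+b. (\<Sum>n<N. cond_avg Q (\<lambda>b. b n) (\<lambda>b. \<Sum>m<N. meet_avg1 m n (a m) b) (b n))\<^sup>2 \<partial>Q) \<le>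
      16 * (\<integral>\<^sup>+b. (\<Sum>n<N. \<Sum>m<N. meet_avg1 m n (a m) b)\<^sup>2 \<partial>Q)"
      by (rule second_moment[where c = "of_nat N"]) (auto intro: sum_le meet_avg1_le_1)
    ultimately show ?thesis
      by (subst (1 2) sum.swap) simp
  qed
  have 2: "(\<integral>\<^sup>+a. (\<Sum>m<N. \<Sum>n<N. meet_avg1 m n (a m) b)\<^sup>2 \<partial>P) \<le>
      4 * (\<integral>\<^sup>+a. (\<Sum>m<N. \<Sum>n<N. meet m n a b)\<^sup>2 \<partial>P)" for b
  proof -
    have "cond_avg P (\<lambda>a. a m) (\<lambda>a. \<Sum>n<N. meet m n a b) z = (\<Sum>n<N. meet_avg1 m n z b)" for m z
      unfolding meet_avg1_def by (rule cond_avg_sum) auto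
    moreover have "(\<integral>\<^sup>+a. (\<Sum>m<N. cond_avg P (\<lambda>a. a m) (\<lambda>a. \<Sum>n<N. meet m n a b) (a m))\<^sup>2 \<partial>P) \<le>
      4 * (\<integral>\<^sup>+a. (\<Sum>m<N. \<Sum>n<N. meet m n a b)\<^sup>2 \<partial>P)"
      by (rule second_moment_adapted[where c = "of_nat N"])
        (auto intro: sum_le meet_le_1 sum.cong meet_adapted)
    ultimately show ?thesis
      by simp
  qed
  have "(\<integral>\<^sup>+a. (\<integral>\<^sup>+b. (\<Sum>m<N. \<Sum>n<N. meet_avg m n (a m) (b n))\<^sup>2 \<partial>Q) \<partial>P) \<le>
      (\<integral>\<^sup>+a. 16 * (\<integral>\<^sup>+b. (\<Sum>m<N. \<Sum>n<N. meet_avg1 m n (a m) b)\<^sup>2 \<partial>Q) \<partial>P)"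
    by (intro nn_integral_mono 1)
  also have "\<dots> = 16 * (\<integral>\<^sup>+a. (\<integral>\<^sup>+b. (\<Sum>m<N. \<Sum>n<N. meet_avg1 m n (a m) b)\<^sup>2 \<partial>Q) \<partial>P)"
  proof (rule nn_integral_cmult)
    have "(\<lambda>(a, b). (\<Sum>m<N. \<Sum>n<N. meet_avg1 m n (a m) b)\<^sup>2) \<in> borel_measurable (P \<Otimes>\<^sub>M Q)"
      using measurable_compose[OF measurable_pair_swap', of "\<lambda>p. (\<Sum>m<N. \<Sum>n<N. meet_avg1 m n (snd p m) (fst p))\<^sup>2" Q P borel]
      by (simp add: split_beta')
    then show "(\<lambda>a. \<integral>\<^sup>+b. (\<Sum>m<N. \<Sum>n<N. meet_avg1 m n (a m) b)\<^sup>2 \<partial>Q) \<in> borel_measurable P"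
      by (rule Q.borel_measurable_nn_integral)
  qed
  also have "(\<integral>\<^sup>+a. (\<integral>\<^sup>+b. (\<Sum>m<N. \<Sum>n<N. meet_avg1 m n (a m) b)\<^sup>2 \<partial>Q) \<partial>P) =
      (\<integral>\<^sup>+b. (\<integral>\<^sup>+a. (\<Sum>m<N. \<Sum>n<N. meet_avg1 m n (a m) b)\<^sup>2 \<partial>P) \<partial>Q)"
    using QP.Fubini'[of "\<lambda>b a. (\<Sum>m<N. \<Sum>n<N. meet_avg1 m n (a m) b)\<^sup>2"]
    by (simp add: split_beta')
  also have "\<dots> \<le> (\<integral>\<^sup>+b. 4 * (\<integral>\<^sup>+a. (\<Sum>m<N. \<Sum>n<N. meet m n a b)\<^sup>2 \<partial>P) \<partial>Q)"
    by (intro nn_integral_mono 2)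
  also have "\<dots> = 4 * (\<integral>\<^sup>+b. (\<integral>\<^sup>+a. (\<Sum>m<N. \<Sum>n<N. meet m n a b)\<^sup>2 \<partial>P) \<partial>Q)"
  proof (rule nn_integral_cmult)
    have "(\<lambda>(b, a). (\<Sum>m<N. \<Sum>n<N. meet m n a b)\<^sup>2) \<in> borel_measurable (Q \<Otimes>\<^sub>M P)"
      by (simp add: split_beta')
    then show "(\<lambda>b. \<integral>\<^sup>+a. (\<Sum>m<N. \<Sum>n<N. meet m n a b)\<^sup>2 \<partial>P) \<in> borel_measurable Q"
      by (rule P.borel_measurable_nn_integral)
  qed
  also have "(\<integral>\<^sup>+b. (\<integral>\<^sup>+a. (\<Sum>m<N. \<Sum>n<N. meet m n a b)\<^sup>2 \<partial>P) \<partial>Q) =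
      (\<integral>\<^sup>+a. (\<integral>\<^sup>+b. (\<Sum>m<N. \<Sum>n<N. meet m n a b)\<^sup>2 \<partial>Q) \<partial>P)"
    using QP.Fubini'[of "\<lambda>b a. (\<Sum>m<N. \<Sum>n<N. meet m n a b)\<^sup>2"]
    by (simp add: split_beta')
  finally show ?thesis
    by (simp add: mult.assoc[symmetric] mult_left_mono)
qed

end

section \<open>Comparison of the two futures along the erased prefix\<close>

lemma measurable_prefix_loop_erasure [measurable]:
  "(\<lambda>a :: nat \<Rightarrow> 's::countable. prefix_loop_erasure m a k) \<in> seq_space \<rightarrow>\<^sub>M count_space UNIV"
  by (rule measurable_prefix_determined[of "Suc m"]) (auto intro!: prefix_loop_erasure_cong[THEN fun_cong])

lemma measurable_hit_index_prefix [measurable]: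
  fixes f g :: "'a \<Rightarrow> nat \<Rightarrow> 's::countable"
  assumes [measurable]: "f \<in> M \<rightarrow>\<^sub>M seq_space" "g \<in> M \<rightarrow>\<^sub>M seq_space"
  shows "(\<lambda>p. hit_index (prefix_loop_erasure m (f p)) (g p)) \<in> M \<rightarrow>\<^sub>M count_space UNIV"
proof -
  have [measurable]: "Measurable.pred M (\<lambda>p. prefix_loop_erasure m (f p) k = g p i)" for k i
    by (rule measurable_pred_eq_countable) measurable
  have "(\<lambda>p. LEAST k. \<exists>i. prefix_loop_erasure m (f p) k = g p i) \<in> M \<rightarrow>\<^sub>M count_space UNIV"
    by measurable
  then show ?thesis
    by (simp add: hit_index_def image_iff)
qed

text \<open>
  Along the loop-erasure of \<open>a 0, \<dots>, a m\<close>, the future of \<open>b\<close> hits no later than the future of \<open>a\<close>.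
  The elements before that hit are not erased by the future of \<open>a\<close>.
\<close>

abbreviation loop_erasure_hit_first :: "nat \<Rightarrow> nat \<Rightarrow> (nat \<Rightarrow> 's) \<Rightarrow> (nat \<Rightarrow> 's) \<Rightarrow> bool" where
  "loop_erasure_hit_first m n a b \<equiv> a m = b n \<and>
    hit_index (prefix_loop_erasure m a) (shift_seq n b) \<le> hit_index (prefix_loop_erasure m a) (shift_seq m a)"

text \<open>Finiteness of \<open>p\<close> permits cancelling \<open>64 * p\<close>, and 16384 / 64
  = 256.\<close>

lemma ennreal_quotient_bound:
  fixes p q :: ennreal
  assumes "128 * p \<le> 64 * p + 16384 * q" "p < \<infinity>"
  shows "p \<le> 256 * q"
proof -
  obtain r where r: "p = ennreal r" "0 \<le> r"
    using assms(2) by (cases p) auto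
  show ?thesis
  proof (cases q)
    case (real s)
    have "ennreal (128 * r) \<le> ennreal (64 * r + 16384 * s)"
      using assms(1) r real by (simp add: ennreal_mult)
    then have "ennreal r \<le> ennreal (256 * s)"
      using real r by (subst (asm) ennreal_le_iff) (auto intro: ennreal_leI)
    then show ?thesis
      using r real by (simp add: ennreal_mult)
  qed (simp add: ennreal_mult_top)
qed

context two_chains
begin

text \<open>On \<open>a m = b n\<close> the two futures are, given the pasts, independent with the
  common law \<open>chain_law K (a m)\<close>, while the erased prefix depends on the past of
  \<open>a\<close> alone. By \<open>nn_integral_le_symmetric\<close> the future of \<open>b\<close>
  hits no later with probability at least 1/2, and the weight \<open>\<kappa>\<close> sees only the
  present states.\<close>

lemma half_loop_erasure_hit_first:
  fixes \<kappa> :: "'s \<Rightarrow> 's \<Rightarrow> ennreal"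
  shows "(\<integral>\<^sup>+a. (\<integral>\<^sup>+b. (if a m = b n then \<kappa> (a m) (b n) else 0) \<partial>Q) \<partial>P) \<le>
    2 * (\<integral>\<^sup>+a. (\<integral>\<^sup>+b. (if loop_erasure_hit_first m n a b then \<kappa> (a m) (b n) else 0) \<partial>Q) \<partial>P)"
proof -
  define L where "L = (prefix_loop_erasure m :: (nat \<Rightarrow> 's) \<Rightarrow> _)"
  \<comment> \<open>The probability that a fresh path from \<open>a m\<close> hits the erased prefix
    of \<open>a\<close> no later than the given future \<open>u\<close> does.\<close>
  define W where "W a u = (\<integral>\<^sup>+v. (if hit_index (L a) v \<le> hit_index (L a) u then 1 else 0 :: ennreal) \<partial>chain_law K (a m))"
    for a u
  define \<kappa>' where "\<kappa>' z = (\<integral>\<^sup>+b. (if z = b n then \<kappa> z (b n) else 0) \<partial>Q)" for z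
  have W_meas [measurable]: "W a \<in> borel_measurable seq_space" for a
  proof -
    have "(\<lambda>u. (\<lambda>k. \<integral>\<^sup>+v. (if hit_index (L a) v \<le> k then 1 else 0 :: ennreal) \<partial>chain_law K (a m)) (hit_index (L a) u))
        \<in> borel_measurable seq_space"
      by (rule measurable_compose[OF measurable_hit_index]) simp
    then show ?thesis
      by (simp add: W_def[abs_def])
  qed
  have \<kappa>_meas [measurable]: "(\<lambda>b. if z = b n then \<kappa> z (b n) else 0) \<in> borel_measurable seq_space" for z
    by (rule measurable_compose[OF measurable_seq_nth, where g = "\<lambda>w. if z = w then \<kappa> z w else 0"]) simp
  \<comment> \<open>Markov property of the second chain at time \<open>n\<close>, with the whole
    first path \<open>a\<close> frozen.\<close>
  have inner: "(\<integral>\<^sup>+b. (if loop_erasure_hit_first m n a b then \<kappa> (a m) (b n) else 0) \<partial>Q) =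
      \<kappa>' (a m) * W a (shift_seq m a)" for a
  proof -
    define c where "c = hit_index (L a) (shift_seq m a)"
    define F where "F b v = (if a m = b n then \<kappa> (a m) (b n) else 0) * (if hit_index (L a) v \<le> c then 1 else 0)"
      for b v
    have "(\<integral>\<^sup>+b. (if loop_erasure_hit_first m n a b then \<kappa> (a m) (b n) else 0) \<partial>Q) =
        (\<integral>\<^sup>+b. F b (shift_seq n b) \<partial>Q)"
      by (intro nn_integral_cong) (auto simp: F_def c_def L_def)
    also have "\<dots> = (\<integral>\<^sup>+b. (\<integral>\<^sup>+v. F b v \<partial>chain_law K (b n)) \<partial>Q)"
    proof (rule markov_property)
      show "F b \<in> borel_measurable seq_space" for b
        unfolding F_def by measurable
    qed (simp add: F_def)
    also have "\<dots> = (\<integral>\<^sup>+b. (if a m = b n then \<kappa> (a m) (b n) else 0) * W a (shift_seq m a) \<partial>Q)"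
    proof (rule nn_integral_cong)
      fix b
      have "(\<integral>\<^sup>+v. F b v \<partial>chain_law K (b n)) = (if a m = b n then \<kappa> (a m) (b n) else 0) *
          (\<integral>\<^sup>+v. (if hit_index (L a) v \<le> c then 1 else 0) \<partial>chain_law K (b n))"
        unfolding F_def by (rule nn_integral_cmult) (simp, measurable)
      then show "(\<integral>\<^sup>+v. F b v \<partial>chain_law K (b n)) =
          (if a m = b n then \<kappa> (a m) (b n) else 0) * W a (shift_seq m a)"
        by (simp add: W_def c_def)
    qed
    also have "\<dots> = \<kappa>' (a m) * W a (shift_seq m a)"
      unfolding \<kappa>'_def by (rule nn_integral_multc) (simp add: \<kappa>_meas)
    finally show ?thesis .
  qed
  have "(\<integral>\<^sup>+a. (\<integral>\<^sup>+b. (if a m = b n then \<kappa> (a m) (b n) else 0) \<partial>Q) \<partial>P) = (\<integral>\<^sup>+a. \<kappa>' (a m) * 1 \<partial>P)"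
    by (simp add: \<kappa>'_def)
  also have "\<dots> \<le> (\<integral>\<^sup>+a. \<kappa>' (a m) * (2 * (\<integral>\<^sup>+u. W a u \<partial>chain_law K (a m))) \<partial>P)"
  proof (intro nn_integral_mono mult_left_mono)
    fix a
    show "1 \<le> 2 * (\<integral>\<^sup>+u. W a u \<partial>chain_law K (a m))"
      unfolding W_def by (rule prob_space.nn_integral_le_symmetric[OF prob_space_chain_law]) simp
  qed simp
  also have "\<dots> = (\<integral>\<^sup>+a. (\<integral>\<^sup>+u. 2 * (\<kappa>' (a m) * W a u) \<partial>chain_law K (a m)) \<partial>P)"
    by (intro nn_integral_cong) (simp add: nn_integral_cmult, simp add: mult.left_commute)
  \<comment> \<open>Markov property of the first chain at time \<open>m\<close>, read backwards: the
    independent copy \<open>u\<close> becomes the actual future of \<open>a\<close>.\<close>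
  also have "\<dots> = (\<integral>\<^sup>+a. 2 * (\<kappa>' (a m) * W a (shift_seq m a)) \<partial>P)"
  proof (rule markov_property[symmetric])
    fix a a' u :: "nat \<Rightarrow> 's" assume eq: "\<And>i. i \<le> m \<Longrightarrow> a i = a' i"
    then have "L a = L a'"
      unfolding L_def by (rule prefix_loop_erasure_cong)
    then show "2 * (\<kappa>' (a m) * W a u) = 2 * (\<kappa>' (a' m) * W a' u)"
      using eq[of m] by (simp add: W_def)
  qed measurable
  also have "\<dots> = 2 * (\<integral>\<^sup>+a. \<kappa>' (a m) * W a (shift_seq m a) \<partial>P)"
  proof (rule nn_integral_cmult)
    \<comment> \<open>\<open>a\<close> enters \<open>W\<close> both as parameter and through its
      future. The parameter matters only through the countably valued prefix, which gives
      measurability.\<close>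
    define Z where "Z a = map a [0..<Suc m]" for a :: "nat \<Rightarrow> 's"
    have "(\<lambda>a. \<kappa>' ((!) (Z a) m) * W ((!) (Z a)) (shift_seq m a)) \<in> borel_measurable seq_space"
      by (rule measurable_compose_countable[where f = "\<lambda>z a. \<kappa>' (z ! m) * W ((!) z) (shift_seq m a)"])
        (simp_all add: Z_def del: upt_Suc)
    moreover have "(!) (Z a) m = a m" for a
      by (simp add: Z_def del: upt_Suc)
    moreover have "W ((!) (Z a)) = W a" for a
    proof -
      have "L ((!) (Z a)) = L a"
        unfolding L_def by (rule prefix_loop_erasure_cong) (simp add: Z_def del: upt_Suc)
      then show ?thesis
        by (simp add: W_def[abs_def] Z_def del: upt_Suc)
    qed
    ultimately show "(\<lambda>a. \<kappa>' (a m) * W a (shift_seq m a)) \<in> borel_measurable P"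
      by (simp only: measurable_chain_law)
  qed
  finally show ?thesis
    unfolding inner .
qed

section \<open>The second moment method on the product space\<close>

abbreviation "PQ \<equiv> P \<Otimes>\<^sub>M Q"

lemma measurable_PQ [simp]: "measurable PQ L = measurable (seq_space \<Otimes>\<^sub>M seq_space) L"
  by (intro measurable_cong_sets sets_pair_measure_cong) simp_all

lemma nn_integral_PQ:
  assumes "f \<in> borel_measurable (seq_space \<Otimes>\<^sub>M seq_space)"
  shows "(\<integral>\<^sup>+\<omega>. f \<omega> \<partial>PQ) = (\<integral>\<^sup>+a. (\<integral>\<^sup>+b. f (a, b) \<partial>Q) \<partial>P)"
  using assms by (intro Q.nn_integral_fst[symmetric]) simp

text \<open>\<open>S\<close> has mean \<open>?p\<close> and second moment at most
  \<open>64 * ?p\<close>. Its part \<open>S'\<close> keeps at least half of the mean and vanishes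
  unless \<open>b\<close> hits the loop-erasure of \<open>a\<close>.\<close>

lemma meet_bound:
  "(\<integral>\<^sup>+\<omega>. (if \<exists>m<N. \<exists>n<N. fst \<omega> m = snd \<omega> n then 1 else 0) \<partial>PQ) \<le>
    256 * (\<integral>\<^sup>+\<omega>. (if \<exists>i j. loop_erasure (fst \<omega>) i = snd \<omega> j then 1 else 0) \<partial>PQ)" (is "?p \<le> 256 * ?q")
proof -
  note [measurable (raw)] = measurable_pred_eq_countable
  define T where "T m n \<omega> = meet_avg m n (fst \<omega> m) (snd \<omega> n)" for m n \<omega>
  define G where "G m n \<omega> = loop_erasure_hit_first m n (fst \<omega>) (snd \<omega>)" for m n and \<omega> :: "(nat \<Rightarrow> 's) \<times> (nat \<Rightarrow> 's)"
  define S where "S \<omega> = (\<Sum>m<N. \<Sum>n<N. T m n \<omega>)" for \<omega>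
  define S' where "S' \<omega> = (\<Sum>m<N. \<Sum>n<N. if G m n \<omega> then T m n \<omega> else 0)" for \<omega>
  have swap_meas: "(\<lambda>p. f (snd p) (fst p)) \<in> borel_measurable (seq_space \<Otimes>\<^sub>M (seq_space :: (nat \<Rightarrow> 's) measure))"
    if "(\<lambda>p. f (fst p) (snd p)) \<in> borel_measurable (seq_space \<Otimes>\<^sub>M (seq_space :: (nat \<Rightarrow> 's) measure))"
    for f :: "(nat \<Rightarrow> 's) \<Rightarrow> (nat \<Rightarrow> 's) \<Rightarrow> ennreal"
    using measurable_compose[OF measurable_pair_swap' that] by (simp add: split_beta')
  have T_meas [measurable]: "T m n \<in> borel_measurable (seq_space \<Otimes>\<^sub>M seq_space)" for m n
    using swap_meas[of "\<lambda>b a. meet_avg m n (a m) (b n)"] weight_measurable[of "meet_avg m n" m n]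
    by (simp add: T_def[abs_def])
  have meet_meas [measurable]: "(\<lambda>\<omega>. meet m n (fst \<omega>) (snd \<omega>)) \<in> borel_measurable (seq_space \<Otimes>\<^sub>M seq_space)" for m n
    using swap_meas[of "\<lambda>b a. meet m n a b"] meet_measurable by simp
  have G_meas [measurable]: "Measurable.pred (seq_space \<Otimes>\<^sub>M seq_space) (G m n)" for m n
    unfolding G_def by measurable
  have S_meas [measurable]: "S \<in> borel_measurable (seq_space \<Otimes>\<^sub>M seq_space)"
    "S' \<in> borel_measurable (seq_space \<Otimes>\<^sub>M seq_space)"
    unfolding S_def S'_def by measurable
  have T_int: "(\<integral>\<^sup>+\<omega>. T m n \<omega> \<partial>PQ) = (\<integral>\<^sup>+\<omega>. meet m n (fst \<omega>) (snd \<omega>) \<partial>PQ)" for m n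
    using nn_integral_meet_avg[of m n "\<lambda>_ _. 1"] by (simp add: nn_integral_PQ T_def[abs_def] T_meas[unfolded T_def[abs_def]])
  have meet_sum: "(\<Sum>m<N. \<Sum>n<N. meet m n a b) = (if \<exists>m<N. \<exists>n<N. a m = b n then 1 else 0)" for a b
    unfolding meet_def by (rule sum_first_meeting)
  have p_eq: "?p = (\<integral>\<^sup>+\<omega>. (\<Sum>m<N. \<Sum>n<N. meet m n (fst \<omega>) (snd \<omega>)) \<partial>PQ)"
    by (simp add: meet_sum)
  have first: "?p = (\<integral>\<^sup>+\<omega>. S \<omega> \<partial>PQ)"
    unfolding p_eq S_def by (simp add: nn_integral_sum T_int)
  have second: "(\<integral>\<^sup>+\<omega>. (S \<omega>)\<^sup>2 \<partial>PQ) \<le> 64 * ?p"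
  proof -
    \<comment> \<open>The sum of \<open>meet\<close> is an indicator and thus equals its
      square.\<close>
    have "?p = (\<integral>\<^sup>+\<omega>. (\<Sum>m<N. \<Sum>n<N. meet m n (fst \<omega>) (snd \<omega>))\<^sup>2 \<partial>PQ)"
      by (intro nn_integral_cong) (simp add: meet_sum)
    also have "\<dots> = (\<integral>\<^sup>+a. (\<integral>\<^sup>+b. (\<Sum>m<N. \<Sum>n<N. meet m n a b)\<^sup>2 \<partial>Q) \<partial>P)"
      by (subst nn_integral_PQ)
        (intro borel_measurable_power_ennreal borel_measurable_sum meet_meas, simp)
    finally have "?p = (\<integral>\<^sup>+a. (\<integral>\<^sup>+b. (\<Sum>m<N. \<Sum>n<N. meet m n a b)\<^sup>2 \<partial>Q) \<partial>P)" .
    moreover have "(\<integral>\<^sup>+\<omega>. (S \<omega>)\<^sup>2 \<partial>PQ) = (\<integral>\<^sup>+a. (\<integral>\<^sup>+b. (\<Sum>m<N. \<Sum>n<N. meet_avg m n (a m) (b n))\<^sup>2 \<partial>Q) \<partial>P)"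
      by (subst nn_integral_PQ)
        (intro borel_measurable_power_ennreal S_meas, simp add: S_def T_def)
    ultimately show ?thesis
      using second_moment_meet_avg by simp
  qed
  have half: "(\<integral>\<^sup>+\<omega>. T m n \<omega> \<partial>PQ) \<le> 2 * (\<integral>\<^sup>+\<omega>. (if G m n \<omega> then T m n \<omega> else 0) \<partial>PQ)" for m n
  proof -
    have "(\<integral>\<^sup>+\<omega>. T m n \<omega> \<partial>PQ) = (\<integral>\<^sup>+a. (\<integral>\<^sup>+b. meet m n a b \<partial>Q) \<partial>P)"
      unfolding T_int by (subst nn_integral_PQ[OF meet_meas]) simp
    \<comment> \<open>A first meeting forces \<open>a m = b n\<close>. The inserted indicator is a
      function of \<open>a m\<close> and \<open>b n\<close>, so it survives the passage to
      \<open>meet_avg\<close>.\<close>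
    also have "\<dots> = (\<integral>\<^sup>+a. (\<integral>\<^sup>+b. meet m n a b * (if a m = b n then 1 else 0) \<partial>Q) \<partial>P)"
      by (intro nn_integral_cong) (auto simp: meet_def first_meeting_def)
    also have "\<dots> = (\<integral>\<^sup>+a. (\<integral>\<^sup>+b. meet_avg m n (a m) (b n) * (if a m = b n then 1 else 0) \<partial>Q) \<partial>P)"
      by (rule nn_integral_meet_avg[symmetric, where \<phi> = "\<lambda>z w. if z = w then 1 else 0"])
    also have "\<dots> = (\<integral>\<^sup>+a. (\<integral>\<^sup>+b. (if a m = b n then meet_avg m n (a m) (b n) else 0) \<partial>Q) \<partial>P)"
      by (intro nn_integral_cong) auto
    also have "\<dots> \<le> 2 * (\<integral>\<^sup>+a. (\<integral>\<^sup>+b. (if loop_erasure_hit_first m n a b then meet_avg m n (a m) (b n) else 0) \<partial>Q) \<partial>P)"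
      by (rule half_loop_erasure_hit_first)
    also have "(\<integral>\<^sup>+a. (\<integral>\<^sup>+b. (if loop_erasure_hit_first m n a b then meet_avg m n (a m) (b n) else 0) \<partial>Q) \<partial>P) =
        (\<integral>\<^sup>+\<omega>. (if G m n \<omega> then T m n \<omega> else 0) \<partial>PQ)"
    proof -
      have meas: "(\<lambda>\<omega>. if G m n \<omega> then T m n \<omega> else 0) \<in> borel_measurable (seq_space \<Otimes>\<^sub>M seq_space)"
        by measurable
      show ?thesis
        unfolding nn_integral_PQ[OF meas] unfolding G_def T_def fst_conv snd_conv ..
    qed
    finally show ?thesis .
  qed
  have "(\<integral>\<^sup>+\<omega>. S \<omega> \<partial>PQ) = (\<Sum>m<N. \<Sum>n<N. \<integral>\<^sup>+\<omega>. T m n \<omega> \<partial>PQ)"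
    unfolding S_def by (simp add: nn_integral_sum)
  also have "\<dots> \<le> (\<Sum>m<N. \<Sum>n<N. 2 * (\<integral>\<^sup>+\<omega>. (if G m n \<omega> then T m n \<omega> else 0) \<partial>PQ))"
    by (intro sum_mono half)
  also have "\<dots> = 2 * (\<integral>\<^sup>+\<omega>. S' \<omega> \<partial>PQ)"
    unfolding S'_def by (simp add: nn_integral_sum sum_distrib_left)
  finally have third: "?p \<le> 2 * (\<integral>\<^sup>+\<omega>. S' \<omega> \<partial>PQ)"
    unfolding first .
  have q_meas [measurable]: "Measurable.pred (seq_space \<Otimes>\<^sub>M (seq_space :: (nat \<Rightarrow> 's) measure))
      (\<lambda>\<omega>. \<exists>i j. loop_erasure (fst \<omega>) i = snd \<omega> j)"
    by measurable
  \<comment> \<open>Linearised Cauchy-Schwarz. With a parameter \<open>t\<close> in place of 64, the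
    bounds \<open>4 * t * S \<le> S^2 + 4 * t^2\<close> on the event and \<open>S' = 0\<close> off
    it yield the ratio \<open>(2 * t - 64) / (4 * t^2)\<close> between \<open>?q\<close> and
    \<open>?p\<close>. It is maximal at \<open>t = 64\<close>, with value 1/256.\<close>
  have "256 * S' \<omega> \<le> (S \<omega>)\<^sup>2 + 16384 * (if \<exists>i j. loop_erasure (fst \<omega>) i = snd \<omega> j then 1 else 0)" for \<omega>
  proof (cases "\<exists>i j. loop_erasure (fst \<omega>) i = snd \<omega> j")
    case True
    have "S' \<omega> \<le> S \<omega>"
      unfolding S_def S'_def by (intro sum_mono) auto
    then have "256 * S' \<omega> \<le> 256 * S \<omega>"
      by (rule mult_left_mono) simp
    also have "\<dots> = 4 * 64 * S \<omega>"
      by simp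
    also have "\<dots> = 4 * (S \<omega> * 64)"
      by (simp only: mult.assoc mult.commute[of "S \<omega>"])
    also have "\<dots> \<le> (S \<omega>)\<^sup>2 + 4 * 64\<^sup>2"
      by (rule ennreal_four_mult_le)
    finally show ?thesis
      using True by simp
  next
    case False
    then have "\<not> G m n \<omega>" for m n
      using loop_erasure_meets[of "fst \<omega>" m "snd \<omega>" n] by (auto simp: G_def)
    then show ?thesis
      by (simp add: S'_def)
  qed
  then have "(\<integral>\<^sup>+\<omega>. 256 * S' \<omega> \<partial>PQ) \<le>
      (\<integral>\<^sup>+\<omega>. (S \<omega>)\<^sup>2 + 16384 * (if \<exists>i j. loop_erasure (fst \<omega>) i = snd \<omega> j then 1 else 0) \<partial>PQ)"
    by (rule nn_integral_mono)
  also have "\<dots> = (\<integral>\<^sup>+\<omega>. (S \<omega>)\<^sup>2 \<partial>PQ) + 16384 * ?q"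
    by (simp add: nn_integral_add nn_integral_cmult)
  also have "\<dots> \<le> 64 * ?p + 16384 * ?q"
    by (intro add_mono second order_refl)
  finally have fourth: "256 * (\<integral>\<^sup>+\<omega>. S' \<omega> \<partial>PQ) \<le> 64 * ?p + 16384 * ?q"
    by (simp add: nn_integral_cmult)
  have "128 * ?p \<le> 128 * (2 * (\<integral>\<^sup>+\<omega>. S' \<omega> \<partial>PQ))"
    by (intro mult_left_mono third) simp
  also have "\<dots> = 256 * (\<integral>\<^sup>+\<omega>. S' \<omega> \<partial>PQ)"
    by (simp add: mult.assoc[symmetric])
  also note fourth
  finally have main: "128 * ?p \<le> 64 * ?p + 16384 * ?q" .
  interpret PQ: pair_prob_space P Q ..
  have le_1: "(\<integral>\<^sup>+\<omega>. (if R \<omega> then 1 else 0) \<partial>PQ) \<le> 1" for R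
    using nn_integral_mono[of PQ "\<lambda>\<omega>. if R \<omega> then 1 else 0" "\<lambda>_. 1"] by (simp add: PQ.emeasure_space_1)
  have p_finite: "?p < \<infinity>"
    by (rule le_less_trans[OF le_1]) simp
  from main p_finite show ?thesis
    by (rule ennreal_quotient_bound)
qed

end

section \<open>Transfer to arbitrary realisations\<close>

text \<open>Multiplication rule for conditional probabilities. For a past of probability zero, on
  which \<open>markov_chain\<close> imposes nothing, both sides of the induction step
  vanish.\<close>

lemma markov_chain_cylinder:
  fixes X :: "nat \<Rightarrow> 'w \<Rightarrow> 's::countable"
  assumes "prob_space M" and chain: "markov_chain M K x X"
  shows "measure M {\<omega> \<in> space M. \<forall>i<n. X i \<omega> = a i} =
    (\<Prod>i<n. pmf (if i = 0 then return_pmf x else K (a (i - 1))) (a i))"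
proof -
  interpret prob_space M by fact
  have X_meas [measurable]: "X n \<in> M \<rightarrow>\<^sub>M count_space UNIV" for n
    using chain by (simp add: markov_chain_def)
  show ?thesis
  proof (induction n)
    case 0
    then show ?case
      by (simp add: prob_space)
  next
    case (Suc n)
    show ?case
    proof (cases n)
      case 0
      have "AE \<omega> in M. X 0 \<omega> = x"
        using chain by (simp add: markov_chain_def)
      then have "measure M {\<omega> \<in> space M. X 0 \<omega> = a 0} = measure M {\<omega> \<in> space M. x = a 0}"
        by (intro measure_eq_AE) auto
      then show ?thesis
        using 0 by (cases "x = a 0") (simp_all add: prob_space)
    next
      case (Suc k)
      let ?past = "{\<omega> \<in> space M. \<forall>i\<le>k. X i \<omega> = a i}"
      let ?both = "{\<omega> \<in> space M. X (Suc k) \<omega> = a (Suc k) \<and> (\<forall>i\<le>k. X i \<omega> = a i)}"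
      have past: "measure M ?past = (\<Prod>i<n. pmf (if i = 0 then return_pmf x else K (a (i - 1))) (a i))"
        using Suc.IH Suc by (simp add: less_Suc_eq_le)
      have both: "{\<omega> \<in> space M. \<forall>i<Suc n. X i \<omega> = a i} = ?both"
        using Suc by (auto simp: less_Suc_eq_le le_Suc_eq)
      have "measure M ?both = measure M ?past * pmf (K (a k)) (a (Suc k))"
      proof (cases "measure M ?past = 0")
        case True
        have "measure M ?both \<le> measure M ?past"
          by (intro finite_measure_mono) auto
        then show ?thesis
          using True by (simp add: measure_le_0_iff)
      next
        case False
        then have "measure M ?both / measure M ?past = pmf (K (a k)) (a (Suc k))"
          using chain unfolding markov_chain_def cond_prob_def by blast
        then show ?thesis
          using False by (simp add: field_simps)
      qed
      then show ?thesis
        unfolding both past using Suc by simp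
    qed
  qed
qed

text \<open>Cylinder probabilities determine the law of the path; this reduces arbitrary
  realisations to canonical trajectories.\<close>

lemma distr_markov_chain:
  fixes X :: "nat \<Rightarrow> 'w \<Rightarrow> 's::countable"
  assumes "prob_space M" and chain: "markov_chain M K x X"
  shows "distr M seq_space (\<lambda>\<omega> m. X m \<omega>) = chain_law K x"
proof -
  interpret prob_space M by fact
  have X_meas [measurable]: "X n \<in> M \<rightarrow>\<^sub>M count_space UNIV" for n
    using chain by (simp add: markov_chain_def)
  have path [measurable]: "(\<lambda>\<omega> m. X m \<omega>) \<in> M \<rightarrow>\<^sub>M seq_space"
    by (rule measurable_PiM_single') auto
  show ?thesis
  proof (rule measure_eqI_cylinder)
    show "finite_measure (distr M seq_space (\<lambda>\<omega> m. X m \<omega>))"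
      using prob_space_distr[OF path] by (rule prob_space.finite_measure)
    fix n and a :: "nat \<Rightarrow> 's"
    have "emeasure (distr M seq_space (\<lambda>\<omega> m. X m \<omega>)) (cylinder n a) =
        emeasure M {\<omega> \<in> space M. \<forall>i<n. X i \<omega> = a i}"
      by (subst emeasure_distr) (auto intro!: arg_cong[where f = "emeasure M"])
    also have "\<dots> = ennreal (\<Prod>i<n. pmf (if i = 0 then return_pmf x else K (a (i - 1))) (a i))"
      by (simp only: emeasure_eq_measure markov_chain_cylinder[OF assms])
    also have "\<dots> = emeasure (chain_law K x) (cylinder n a)"
      unfolding emeasure_chain_law_cylinder by (rule prod_ennreal[symmetric]) simp
    finally show "emeasure (distr M seq_space (\<lambda>\<omega> m. X m \<omega>)) (cylinder n a) = emeasure (chain_law K x) (cylinder n a)" .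
  qed simp_all
qed

text \<open>The right side of \<open>meet_bound\<close> is free of \<open>N\<close>, and the events
  of meeting before \<open>N\<close> increase to the event of meeting at all.\<close>

lemma chain_law_loop_erasure_intersection:
  fixes K :: "'s::countable \<Rightarrow> 's pmf" and x y :: 's
  defines "PQ \<equiv> chain_law K x \<Otimes>\<^sub>M chain_law K y"
  shows "emeasure PQ {\<omega> \<in> space PQ. \<exists>m n. fst \<omega> m = snd \<omega> n} \<le>
    256 * emeasure PQ {\<omega> \<in> space PQ. \<exists>i j. loop_erasure (fst \<omega>) i = snd \<omega> j}"
proof -
  note [measurable (raw)] = measurable_pred_eq_countable
  have PQ_meas [simp]: "measurable PQ L = measurable (seq_space \<Otimes>\<^sub>M seq_space) L" for L :: "'z measure"
    unfolding PQ_def by (intro measurable_cong_sets sets_pair_measure_cong) simp_all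
  define A where "A N = {\<omega> \<in> space PQ. \<exists>m<N. \<exists>n<N. fst \<omega> m = snd \<omega> n}" for N
  have A_sets: "A N \<in> sets PQ" for N
  proof -
    have "Measurable.pred PQ (\<lambda>\<omega>. \<exists>m<N. \<exists>n<N. fst \<omega> m = snd \<omega> n)"
      unfolding PQ_meas by measurable
    then show ?thesis
      unfolding A_def by (rule predE)
  qed
  have L_sets: "{\<omega> \<in> space PQ. \<exists>i j. loop_erasure (fst \<omega>) i = snd \<omega> j} \<in> sets PQ"
  proof -
    have "Measurable.pred PQ (\<lambda>\<omega>. \<exists>i j. loop_erasure (fst \<omega>) i = snd \<omega> j)"
      unfolding PQ_meas by measurable
    then show ?thesis
      by (rule predE)
  qed
  have int: "(\<integral>\<^sup>+\<omega>. (if R \<omega> then 1 else 0) \<partial>PQ) = emeasure PQ {\<omega> \<in> space PQ. R \<omega>}"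
    if "{\<omega> \<in> space PQ. R \<omega>} \<in> sets PQ" for R
  proof -
    have "(\<integral>\<^sup>+\<omega>. (if R \<omega> then 1 else 0) \<partial>PQ) = (\<integral>\<^sup>+\<omega>. indicator {\<omega> \<in> space PQ. R \<omega>} \<omega> \<partial>PQ)"
      by (intro nn_integral_cong) auto
    then show ?thesis
      using that by simp
  qed
  have "emeasure PQ (A N) \<le> 256 * emeasure PQ {\<omega> \<in> space PQ. \<exists>i j. loop_erasure (fst \<omega>) i = snd \<omega> j}" for N
    using two_chains.meet_bound[of K x y N] unfolding PQ_def[symmetric]
    by (simp only: int[OF A_sets[unfolded A_def]] int[OF L_sets] A_def)
  then have "(SUP N. emeasure PQ (A N)) \<le> 256 * emeasure PQ {\<omega> \<in> space PQ. \<exists>i j. loop_erasure (fst \<omega>) i = snd \<omega> j}"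
    by (rule SUP_least)
  moreover have "incseq A"
    unfolding incseq_def A_def by (blast intro: less_le_trans)
  then have "(SUP N. emeasure PQ (A N)) = emeasure PQ (\<Union>N. A N)"
    using A_sets by (intro SUP_emeasure_incseq) auto
  moreover have "(\<Union>N. A N) = {\<omega> \<in> space PQ. \<exists>m n. fst \<omega> m = snd \<omega> n}"
  proof (intro equalityI subsetI)
    fix \<omega> assume "\<omega> \<in> {\<omega> \<in> space PQ. \<exists>m n. fst \<omega> m = snd \<omega> n}"
    then obtain m n where "\<omega> \<in> space PQ" "fst \<omega> m = snd \<omega> n"
      by auto
    then have "\<omega> \<in> A (Suc (max m n))"
      unfolding A_def by (auto simp: less_Suc_eq_le intro: max.cobounded1 max.cobounded2)
    then show "\<omega> \<in> (\<Union>N. A N)"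
      by blast
  qed (auto simp: A_def)
  ultimately show ?thesis
    by simp
qed

theorem lemma1p2:
  fixes M :: "'w measure"
    and K :: "'s::countable \<Rightarrow> 's pmf"
    and x y :: 's
    and X Y :: "nat \<Rightarrow> 'w \<Rightarrow> 's"
  assumes "prob_space M"
    and "markov_chain M K x X"
    and "markov_chain M K y Y"
    and "transient_kernel K"
    and "prob_space.indep_var M
           (PiM UNIV (\<lambda>_::nat. count_space (UNIV :: 's set))) (\<lambda>\<omega> m. X m \<omega>)
           (PiM UNIV (\<lambda>_::nat. count_space (UNIV :: 's set))) (\<lambda>\<omega> n. Y n \<omega>)"
  shows "\<P>(\<omega> in M. range (loop_erasure (\<lambda>m. X m \<omega>)) \<inter> range (\<lambda>n. Y n \<omega>) \<noteq> {})
       \<ge> 1 / 2 ^ 8 * \<P>(\<omega> in M. range (\<lambda>m. X m \<omega>) \<inter> range (\<lambda>n. Y n \<omega>) \<noteq> {})"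
proof -
  interpret prob_space M by fact
  note [measurable (raw)] = measurable_pred_eq_countable
  define PQ where "PQ = chain_law K x \<Otimes>\<^sub>M chain_law K y"
  define XY where "XY \<omega> = (\<lambda>m. X m \<omega>, \<lambda>n. Y n \<omega>)" for \<omega>
  have indep: "random_variable seq_space (\<lambda>\<omega> m. X m \<omega>)" "random_variable seq_space (\<lambda>\<omega> n. Y n \<omega>)"
    and joint: "distr M seq_space (\<lambda>\<omega> m. X m \<omega>) \<Otimes>\<^sub>M distr M seq_space (\<lambda>\<omega> n. Y n \<omega>) =
      distr M (seq_space \<Otimes>\<^sub>M seq_space) (\<lambda>\<omega>. (\<lambda>m. X m \<omega>, \<lambda>n. Y n \<omega>))"
    using assms(5) unfolding indep_var_distribution_eq by auto
  note [measurable] = indep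
  have XY_meas: "XY \<in> M \<rightarrow>\<^sub>M seq_space \<Otimes>\<^sub>M seq_space"
    unfolding XY_def by measurable
  \<comment> \<open>Independence makes the joint law of the two paths the product of their laws,
    each of which is a \<open>chain_law\<close>.\<close>
  have law: "distr M (seq_space \<Otimes>\<^sub>M seq_space) XY = PQ"
    using joint unfolding XY_def[abs_def] PQ_def
    by (simp add: distr_markov_chain[OF assms(1,2)] distr_markov_chain[OF assms(1,3)])
  have transfer: "emeasure M {\<omega> \<in> space M. R (XY \<omega>)} = emeasure PQ {\<omega> \<in> space PQ. R \<omega>}"
    if "Measurable.pred (seq_space \<Otimes>\<^sub>M seq_space) R" for R
  proof -
    have "{\<omega> \<in> space (seq_space \<Otimes>\<^sub>M seq_space). R \<omega>} \<in> sets (seq_space \<Otimes>\<^sub>M seq_space)"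
      using that by (rule predE)
    then show ?thesis
      unfolding law[symmetric] using measurable_space[OF XY_meas]
      by (subst emeasure_distr[OF XY_meas]) (auto intro!: arg_cong[where f = "emeasure M"])
  qed
  have "emeasure M {\<omega> \<in> space M. \<exists>m n. fst (XY \<omega>) m = snd (XY \<omega>) n} \<le>
      256 * emeasure M {\<omega> \<in> space M. \<exists>i j. loop_erasure (fst (XY \<omega>)) i = snd (XY \<omega>) j}"
    using chain_law_loop_erasure_intersection[of K x y, folded PQ_def]
    by (subst (1 2) transfer) measurable
  moreover have "{\<omega> \<in> space M. \<exists>m n. fst (XY \<omega>) m = snd (XY \<omega>) n} =
      {\<omega> \<in> space M. range (\<lambda>m. X m \<omega>) \<inter> range (\<lambda>n. Y n \<omega>) \<noteq> {}}"
    unfolding XY_def fst_conv snd_conv by blast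
  moreover have "{\<omega> \<in> space M. \<exists>i j. loop_erasure (fst (XY \<omega>)) i = snd (XY \<omega>) j} =
      {\<omega> \<in> space M. range (loop_erasure (\<lambda>m. X m \<omega>)) \<inter> range (\<lambda>n. Y n \<omega>) \<noteq> {}}"
    unfolding XY_def fst_conv snd_conv by blast
  ultimately have "ennreal (\<P>(\<omega> in M. range (\<lambda>m. X m \<omega>) \<inter> range (\<lambda>n. Y n \<omega>) \<noteq> {})) \<le>
      ennreal (256 * \<P>(\<omega> in M. range (loop_erasure (\<lambda>m. X m \<omega>)) \<inter> range (\<lambda>n. Y n \<omega>) \<noteq> {}))"
    by (simp add: emeasure_eq_measure ennreal_mult)
  then show ?thesis
    by (subst (asm) ennreal_le_iff) auto
qed

end
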